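(* Let $p,g_1,\ldots,g_m$ be real polynomials in $n$ variables, $S=\{x\in\mathbb{R}^n: g_i(x)\ge0,\ i=1,\ldots,m\}$, $p^*=\inf_{x\in S}p(x)$, and let $d,R,\eta_i,\beta$ and $f_\gamma$ be as in the context; put $N=n+m+3$, $D=2d$. For $r\ge1$ define $$l_r:=\sup\Big\{\gamma\in\mathbb{R}: f_\gamma(z)-\tfrac1r\Big(\sum_{i=1}^N z_i^2\Big)^{D}\in R^r_{N,2D}\Big\},$$ where $R^r_{N,2D}$ is the set of forms $q$ in $N$ variables of degree $2D$ such that $q(z)\cdot\big(\sum_{i=1}^N z_i^2\big)^r$ is a sum of squares of polynomials. Then $l_r\le p^*$ for all $r$, $\{l_r\}$ is nondecreasing, and $\lim_{r\to\infty}l_r=p^*$.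
   Context: Data of the polynomial optimization problem $\inf_{x\in S}p(x)$: $d\ge1$ is such that $2d$ is the smallest positive even integer larger than or equal to the maximum degree of $p,g_1,\ldots,g_m$; $R>0$ satisfies $\sum_i x_i^2\le R$ for all $x\in S$; $\eta_i,\beta\in\mathbb{R}$ satisfy $g_i(x)\le\eta_i$ and $-p(x)\le\beta$ for all $x\in S$. With $z=(z_1,\ldots,z_N)=(x_1,\ldots,x_n,s_0,\ldots,s_{m+1},y)$, $$f_\gamma(z):=\left(\gamma y^{2d}-y^{2d}p(x/y)-s_0^2y^{2d-2}\right)^2+\sum_{i=1}^m\left(y^{2d}g_i(x/y)-s_i^2y^{2d-2}\right)^2+\left(\Big(R+\sum_{i=1}^m\eta_i+\beta+\gamma\Big)^dy^{2d}-\Big(\sum_{i=1}^n x_i^2+\sum_{i=0}^m s_i^2\Big)^d-s_{m+1}^{2d}\right)^2 ,$$ a form of degree $4d=2D$ in $N=n+m+3$ variables, where $y^{2d}q(x/y)$ is the degree-$2d$ homogenization of $q$. Convention: $\sup\emptyset=-\infty$. *)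

theory Defs
  imports "HOL-Analysis.Analysis" "HOL-Library.Poly_Mapping"
begin

text \<open>
  Real polynomials in variables indexed by natural numbers: finitely supported functions
  from exponent vectors to coefficients. The ring structure (convolution product) is the
  one of \<^theory>\<open>HOL-Library.Poly_Mapping\<close>. The variables \<open>x\<^sub>1, \<dots>, x\<^sub>n\<close> are numbered
  \<open>0, \<dots>, n - 1\<close>.
\<close>

type_synonym real_mpoly = "(nat \<Rightarrow>\<^sub>0 nat) \<Rightarrow>\<^sub>0 real"

definition Const :: "real \<Rightarrow> real_mpoly" where
  "Const c = Poly_Mapping.single 0 c"

definition Var :: "nat \<Rightarrow> real_mpoly" where
  "Var i = Poly_Mapping.single (Poly_Mapping.single i 1) 1"

definition mpolys :: "nat \<Rightarrow> real_mpoly set" where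
  "mpolys n = {q. \<forall>e\<in>Poly_Mapping.keys q. Poly_Mapping.keys e \<subseteq> {..<n}}"

definition monom_degree :: "(nat \<Rightarrow>\<^sub>0 nat) \<Rightarrow> nat" where
  "monom_degree e = (\<Sum>i\<in>Poly_Mapping.keys e. Poly_Mapping.lookup e i)"

text \<open>Total degree; the zero polynomial gets degree 0.\<close>

definition total_degree :: "real_mpoly \<Rightarrow> nat" where
  "total_degree q = Max (insert 0 (monom_degree ` Poly_Mapping.keys q))"

definition eval_mpoly :: "real_mpoly \<Rightarrow> (nat \<Rightarrow> real) \<Rightarrow> real" where
  "eval_mpoly q x =
     (\<Sum>e\<in>Poly_Mapping.keys q. Poly_Mapping.lookup q e *
        (\<Prod>i\<in>Poly_Mapping.keys e. x i ^ Poly_Mapping.lookup e i))"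

definition forms :: "nat \<Rightarrow> nat \<Rightarrow> real_mpoly set" where
  "forms N k = {q \<in> mpolys N. \<forall>e\<in>Poly_Mapping.keys q. monom_degree e = k}"

definition is_sos :: "nat \<Rightarrow> real_mpoly \<Rightarrow> bool" where
  "is_sos N q \<longleftrightarrow> (\<exists>hs. set hs \<subseteq> mpolys N \<and> q = (\<Sum>h\<leftarrow>hs. h ^ 2))"

definition sq_norm :: "nat \<Rightarrow> real_mpoly" where
  "sq_norm N = (\<Sum>i<N. Var i ^ 2)"

text \<open>\<open>sos_mult_forms N k r\<close> is \<open>R\<^sup>r\<close> with subscript \<open>N, k\<close>; here \<open>k\<close> is the full degree
  (\<open>k = 2 D\<close> in the usual notation).\<close>

definition sos_mult_forms :: "nat \<Rightarrow> nat \<Rightarrow> nat \<Rightarrow> real_mpoly set" where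
  "sos_mult_forms N k r = {q \<in> forms N k. is_sos N (q * sq_norm N ^ r)}"

text \<open>\<open>homogenize k v q\<close> is \<open>y\<^sup>k q(x/y)\<close>, where \<open>y\<close> is variable number \<open>v\<close>: each monomial
  of \<open>q\<close> is multiplied by the power of \<open>y\<close> that brings its degree to \<open>k\<close>. It is only
  meaningful if \<open>total_degree q \<le> k\<close>, since the subtraction is truncated.\<close>

definition homogenize :: "nat \<Rightarrow> nat \<Rightarrow> real_mpoly \<Rightarrow> real_mpoly" where
  "homogenize k v q =
     (\<Sum>e\<in>Poly_Mapping.keys q.
        Poly_Mapping.single (e + Poly_Mapping.single v (k - monom_degree e))
          (Poly_Mapping.lookup q e))"

text \<open>Points of \<open>n\<close>-space are the extensional functions on \<open>{..<n}\<close>.\<close>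

definition feasible_set :: "nat \<Rightarrow> nat \<Rightarrow> (nat \<Rightarrow> real_mpoly) \<Rightarrow> (nat \<Rightarrow> real) set" where
  "feasible_set n m g =
     {x \<in> {..<n} \<rightarrow>\<^sub>E UNIV. \<forall>i\<in>{1..m}. eval_mpoly (g i) x \<ge> 0}"

text \<open>
  The form \<open>f\<^sub>\<gamma>\<close> in \<open>N = n + m + 3\<close> variables. The order is
  \<open>z = (x\<^sub>1, \<dots>, x\<^sub>n, s\<^sub>0, \<dots>, s\<^sub>m\<^sub>+\<^sub>1, y)\<close>, so \<open>s\<^sub>i\<close> has number \<open>n + i\<close> and \<open>y\<close> has
  number \<open>n + m + 2\<close>.
\<close>

definition f_form ::
  "nat \<Rightarrow> nat \<Rightarrow> nat \<Rightarrow> real_mpoly \<Rightarrow> (nat \<Rightarrow> real_mpoly) \<Rightarrow> real \<Rightarrow> (nat \<Rightarrow> real) \<Rightarrow> real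
    \<Rightarrow> real \<Rightarrow> real_mpoly" where
  "f_form n m d p g R \<eta> \<beta> \<gamma> =
     (let s = (\<lambda>i. Var (n + i)); v = n + m + 2; y = Var v in
        (Const \<gamma> * y ^ (2 * d) - homogenize (2 * d) v p - s 0 ^ 2 * y ^ (2 * d - 2)) ^ 2
      + (\<Sum>i=1..m. (homogenize (2 * d) v (g i) - s i ^ 2 * y ^ (2 * d - 2)) ^ 2)
      + (Const ((R + (\<Sum>i=1..m. \<eta> i) + \<beta> + \<gamma>) ^ d) * y ^ (2 * d)
          - ((\<Sum>i<n. Var i ^ 2) + (\<Sum>i=0..m. s i ^ 2)) ^ d
          - s (m + 1) ^ (2 * d)) ^ 2)"

text \<open>\<open>l\<^sub>r\<close>, with \<open>N = n + m + 3\<close> and \<open>D = 2 d\<close>. In \<^typ>\<open>ereal\<close>, the supremum of the empty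
  set is \<open>-\<infinity>\<close>.\<close>

definition lower_bound ::
  "nat \<Rightarrow> nat \<Rightarrow> nat \<Rightarrow> real_mpoly \<Rightarrow> (nat \<Rightarrow> real_mpoly) \<Rightarrow> real \<Rightarrow> (nat \<Rightarrow> real) \<Rightarrow> real
    \<Rightarrow> nat \<Rightarrow> ereal" where
  "lower_bound n m d p g R \<eta> \<beta> r =
     (let N = n + m + 3; D = 2 * d in
      SUP \<gamma>\<in>{\<gamma>. f_form n m d p g R \<eta> \<beta> \<gamma> - Const (1 / real r) * sq_norm N ^ D
                 \<in> sos_mult_forms N (2 * D) r}. ereal \<gamma>)"

end

theory Submission
  imports Defs
begin

text \<open>
  Everything rests on two facts about the form \<open>f\<^sub>\<gamma>\<close>, which is a sum of squares of
  polynomials.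

  A common zero of these squares with \<open>y = 1\<close> amounts to a feasible point \<open>x\<close> with
  \<open>p(x) \<le> \<gamma>\<close>: the slack variables \<open>s\<^sub>0, \<dots>, s\<^sub>m\<close> are square roots of \<open>\<gamma> - p(x)\<close> and of
  the \<open>g\<^sub>i(x)\<close>, and the bounds \<open>R\<close>, \<open>\<eta>\<^sub>i\<close>, \<open>\<beta>\<close> ensure that the last slack variable, a
  \<open>2d\<close>-th root, exists (\<open>f_form_vanishes\<close>). The last square also forbids nontrivial zeros with
  \<open>y = 0\<close>, since there it is the square of a positive definite form. By homogeneity
  \<open>f\<^sub>\<gamma>\<close> is therefore positive definite as soon as \<open>\<gamma> < p\<^sup>*\<close>
  (\<open>f_form_zero_imp_feasible\<close>).

  If \<open>\<gamma>\<close> is certified at level \<open>r\<close>, then \<open>f\<^sub>\<gamma>\<close> is at least \<open>\<bar>z\<bar>\<^sup>4\<^sup>d / r\<close>, hence has no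
  nontrivial zero, hence \<open>\<gamma> \<le> p\<^sup>*\<close>. A certificate survives the passage to a larger \<open>r\<close>,
  because \<open>\<bar>z\<bar>\<^sup>2\<close> is a sum of squares (\<open>sos_mult_forms_mono\<close>). For convergence, \<open>\<gamma> < p\<^sup>*\<close>
  gives \<open>f\<^sub>\<gamma> \<ge> \<delta> > 0\<close> on the unit sphere, so \<open>f\<^sub>\<gamma> - \<bar>z\<bar>\<^sup>4\<^sup>d / r\<^sub>0\<close> is positive definite for
  some \<open>r\<^sub>0\<close>, and Reznick's theorem (\<open>positive_definite_form_uniform_denominator\<close>) supplies
  a power of \<open>\<bar>z\<bar>\<^sup>2\<close> whose product with it is a sum of squares.

  Reznick's theorem is proved here without integration. Let \<open>q\<close> be positive on the unit
  sphere. Adding a large multiple of \<open>(1 - \<bar>x\<bar>\<^sup>2)\<^sup>2\<close>, which changes nothing on the sphere, makes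
  \<open>q\<close> positive on the cube \<open>[-1, 1]\<^sup>N\<close>. There its Bernstein coefficients of high degree are
  nonnegative, so \<open>q\<close> is a nonnegative combination of products of the factors
  \<open>(1 \<plusminus> x\<^sub>i) / 2\<close>, and each of these factors agrees on the sphere with a sum of squares
  (\<open>positive_on_sphere_imp_sos_on_sphere\<close>). Substituting \<open>x / \<bar>x\<bar>\<close> in the resulting
  sum of squares and clearing denominators gives the identity between forms; separating
  even and odd parts keeps odd powers of \<open>\<bar>x\<bar>\<close> out of it (\<open>sos_homogenization\<close>).
\<close>

section \<open>Polynomials and the functions they define\<close>

definition monom_eval :: "(nat \<Rightarrow>\<^sub>0 nat) \<Rightarrow> (nat \<Rightarrow> real) \<Rightarrow> real" where
  "monom_eval e x = (\<Prod>i\<in>Poly_Mapping.keys e. x i ^ Poly_Mapping.lookup e i)"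

lemma monom_eval_superset:
  assumes "finite I" "Poly_Mapping.keys e \<subseteq> I"
  shows "monom_eval e x = (\<Prod>i\<in>I. x i ^ Poly_Mapping.lookup e i)"
  unfolding monom_eval_def
  by (rule prod.mono_neutral_left) (use assms in \<open>auto simp: in_keys_iff\<close>)

lemma monom_eval_plus: "monom_eval (e + f) x = monom_eval e x * monom_eval f x"
proof -
  let ?I = "Poly_Mapping.keys e \<union> Poly_Mapping.keys f"
  have "Poly_Mapping.keys (e + f) \<subseteq> ?I" by (rule Poly_Mapping.keys_add)
  then show ?thesis
    using monom_eval_superset[of ?I "e + f"] monom_eval_superset[of ?I e] monom_eval_superset[of ?I f]
    by (simp add: lookup_add power_add prod.distrib)
qed

lemma monom_eval_single [simp]: "monom_eval (Poly_Mapping.single i k) x = x i ^ k"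
  by (simp add: monom_eval_def)

lemma monom_eval_zero [simp]: "monom_eval 0 x = 1"
  by (simp add: monom_eval_def)

lemma monom_degree_superset:
  assumes "finite I" "Poly_Mapping.keys e \<subseteq> I"
  shows "monom_degree e = (\<Sum>i\<in>I. Poly_Mapping.lookup e i)"
  unfolding monom_degree_def
  by (rule sum.mono_neutral_left) (use assms in \<open>auto simp: in_keys_iff\<close>)

lemma monom_degree_plus: "monom_degree (e + f) = monom_degree e + monom_degree f"
proof -
  let ?I = "Poly_Mapping.keys e \<union> Poly_Mapping.keys f"
  have "Poly_Mapping.keys (e + f) \<subseteq> ?I" by (rule Poly_Mapping.keys_add)
  then show ?thesis
    using monom_degree_superset[of ?I "e + f"] monom_degree_superset[of ?I e] monom_degree_superset[of ?I f]
    by (simp add: lookup_add sum.distrib)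
qed

lemma monom_degree_single [simp]: "monom_degree (Poly_Mapping.single i k) = k"
  by (simp add: monom_degree_def)

lemma monom_degree_zero [simp]: "monom_degree 0 = 0"
  by (simp add: monom_degree_def)

lemma monom_eval_scale: "monom_eval e (\<lambda>i. c * x i) = c ^ monom_degree e * monom_eval e x"
  by (simp add: monom_eval_def monom_degree_def power_mult_distrib prod.distrib power_sum)

lemma eval_mpoly_monom_eval:
  "eval_mpoly q x = (\<Sum>e\<in>Poly_Mapping.keys q. Poly_Mapping.lookup q e * monom_eval e x)"
  by (simp add: eval_mpoly_def monom_eval_def)

lemma eval_mpoly_superset:
  assumes "finite A" "Poly_Mapping.keys q \<subseteq> A"
  shows "eval_mpoly q x = (\<Sum>e\<in>A. Poly_Mapping.lookup q e * monom_eval e x)"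
  unfolding eval_mpoly_monom_eval
  by (rule sum.mono_neutral_left) (use assms in \<open>auto simp: in_keys_iff\<close>)

lemma mpoly_as_sum_of_terms:
  fixes q :: real_mpoly
  shows "q = (\<Sum>e\<in>Poly_Mapping.keys q. Poly_Mapping.single e (Poly_Mapping.lookup q e))"
proof (rule poly_mapping_eqI)
  fix k
  have "(\<Sum>e\<in>Poly_Mapping.keys q. Poly_Mapping.lookup (Poly_Mapping.single e (Poly_Mapping.lookup q e)) k)
      = (\<Sum>e\<in>Poly_Mapping.keys q. if k = e then Poly_Mapping.lookup q e else 0)"
    by (intro sum.cong) (auto simp: lookup_single when_def)
  also have "\<dots> = Poly_Mapping.lookup q k" by (auto simp: in_keys_iff)
  finally show "Poly_Mapping.lookup q k =
      Poly_Mapping.lookup (\<Sum>e\<in>Poly_Mapping.keys q. Poly_Mapping.single e (Poly_Mapping.lookup q e)) k"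
    by (simp add: lookup_sum)
qed

lemma eval_mpoly_zero [simp]: "eval_mpoly 0 x = 0"
  by (simp add: eval_mpoly_def)

lemma eval_mpoly_single [simp]: "eval_mpoly (Poly_Mapping.single e c) x = c * monom_eval e x"
  by (simp add: eval_mpoly_monom_eval)

lemma eval_mpoly_add [simp]: "eval_mpoly (p + q) x = eval_mpoly p x + eval_mpoly q x"
proof -
  let ?A = "Poly_Mapping.keys p \<union> Poly_Mapping.keys q"
  have "Poly_Mapping.keys (p + q) \<subseteq> ?A" by (rule Poly_Mapping.keys_add)
  then show ?thesis
    using eval_mpoly_superset[of ?A "p + q"] eval_mpoly_superset[of ?A p] eval_mpoly_superset[of ?A q]
    by (simp add: lookup_add sum.distrib algebra_simps)
qed

lemma eval_mpoly_sum [simp]: "eval_mpoly (\<Sum>i\<in>I. q i) x = (\<Sum>i\<in>I. eval_mpoly (q i) x)"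
  by (induction I rule: infinite_finite_induct) auto

lemma eval_mpoly_uminus [simp]: "eval_mpoly (- q) x = - eval_mpoly q x"
  using eval_mpoly_add[of q "- q" x] by (simp del: eval_mpoly_add)

lemma eval_mpoly_diff [simp]: "eval_mpoly (p - q) x = eval_mpoly p x - eval_mpoly q x"
  using eval_mpoly_add[of p "- q" x] by (simp del: eval_mpoly_add)

lemma eval_mpoly_mult [simp]: "eval_mpoly (p * q) x = eval_mpoly p x * eval_mpoly q x"
proof -
  let ?t = "\<lambda>q e. Poly_Mapping.single e (Poly_Mapping.lookup q e) :: real_mpoly"
  have "p * q = (\<Sum>e\<in>Poly_Mapping.keys p. ?t p e) * (\<Sum>e\<in>Poly_Mapping.keys q. ?t q e)"
    by (simp flip: mpoly_as_sum_of_terms)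
  also have "\<dots> = (\<Sum>e\<in>Poly_Mapping.keys p. \<Sum>f\<in>Poly_Mapping.keys q. ?t p e * ?t q f)"
    by (rule sum_product)
  finally have "eval_mpoly (p * q) x =
      (\<Sum>e\<in>Poly_Mapping.keys p. \<Sum>f\<in>Poly_Mapping.keys q.
        (Poly_Mapping.lookup p e * monom_eval e x) * (Poly_Mapping.lookup q f * monom_eval f x))"
    by (simp add: mult_single monom_eval_plus mult_ac)
  then show ?thesis by (simp add: eval_mpoly_monom_eval sum_product)
qed

lemma eval_mpoly_Const [simp]: "eval_mpoly (Const c) x = c"
  by (simp add: Const_def)

lemma eval_mpoly_Var [simp]: "eval_mpoly (Var i) x = x i"
  by (simp add: Var_def)

lemma Const_one: "Const 1 = 1"
  by (simp add: Const_def)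

lemma eval_mpoly_one [simp]: "eval_mpoly 1 x = 1"
  by (simp flip: Const_one)

lemma eval_mpoly_power [simp]: "eval_mpoly (q ^ k) x = eval_mpoly q x ^ k"
  by (induction k) auto

lemma eval_mpoly_prod [simp]: "eval_mpoly (\<Prod>i\<in>I. q i) x = (\<Prod>i\<in>I. eval_mpoly (q i) x)"
  by (induction I rule: infinite_finite_induct) auto

lemma eval_mpoly_sum_list: "eval_mpoly (\<Sum>h\<leftarrow>hs. q h) x = (\<Sum>h\<leftarrow>hs. eval_mpoly (q h) x)"
  by (induction hs) auto

lemma eval_mpoly_sq_norm [simp]: "eval_mpoly (sq_norm N) x = (\<Sum>i<N. x i ^ 2)"
  by (simp add: sq_norm_def)

lemma eval_mpoly_cong:
  assumes "q \<in> mpolys N" "\<And>i. i < N \<Longrightarrow> x i = y i"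
  shows "eval_mpoly q x = eval_mpoly q y"
  unfolding eval_mpoly_def
proof (intro sum.cong refl arg_cong2[where f = "(*)"] prod.cong)
  fix e i assume "e \<in> Poly_Mapping.keys q" "i \<in> Poly_Mapping.keys e"
  then have "i < N" using assms(1) by (auto simp: mpolys_def)
  then show "x i ^ Poly_Mapping.lookup e i = y i ^ Poly_Mapping.lookup e i" using assms(2) by simp
qed

lemma base_expansion_inj:
  fixes e f :: "nat \<Rightarrow> nat"
  assumes "\<And>i. i < N \<Longrightarrow> e i < b" "\<And>i. i < N \<Longrightarrow> f i < b"
    and "(\<Sum>i<N. e i * b ^ i) = (\<Sum>i<N. f i * b ^ i)"
  shows "\<forall>i<N. e i = f i"
  using assms
proof (induction N arbitrary: e f)
  case (Suc N)
  have split: "(\<Sum>i<Suc N. h i * b ^ i) = h 0 + b * (\<Sum>i<N. h (Suc i) * b ^ i)" for h :: "nat \<Rightarrow> nat"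
    by (simp only: sum.lessThan_Suc_shift) (simp add: sum_distrib_left mult_ac)
  have eq: "e 0 + b * (\<Sum>i<N. e (Suc i) * b ^ i) = f 0 + b * (\<Sum>i<N. f (Suc i) * b ^ i)"
    using Suc.prems(3) by (simp only: split)
  have lt: "e 0 < b" "f 0 < b" using Suc.prems by auto
  have "e 0 = f 0" using arg_cong[OF eq, of "\<lambda>k. k mod b"] lt by simp
  moreover from this eq lt have "(\<Sum>i<N. e (Suc i) * b ^ i) = (\<Sum>i<N. f (Suc i) * b ^ i)" by simp
  then have "\<forall>i<N. e (Suc i) = f (Suc i)"
    by (intro Suc.IH) (use Suc.prems in auto)
  ultimately show ?case by (auto simp: less_Suc_eq_0_disj)
qed simp

text \<open>
  The substitution \<open>x\<^sub>i = t^(b^i)\<close> turns distinct monomials with exponents below \<open>b\<close> into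
  distinct powers of \<open>t\<close>, so that a polynomial vanishing everywhere yields a
  vanishing univariate polynomial with the same coefficients.
\<close>

lemma eval_mpoly_eq_0_imp:
  assumes "\<And>x. eval_mpoly q x = 0"
  shows "q = 0"
proof -
  let ?K = "Poly_Mapping.keys q"
  obtain N where N: "\<And>e. e \<in> ?K \<Longrightarrow> Poly_Mapping.keys e \<subseteq> {..<N}"
  proof -
    have "finite (\<Union>e\<in>?K. Poly_Mapping.keys e)" by simp
    then obtain N where "(\<Union>e\<in>?K. Poly_Mapping.keys e) \<subseteq> {..<N}"
      using finite_nat_iff_bounded by blast
    then show ?thesis using that by blast
  qed
  obtain b where b: "\<And>e i. e \<in> ?K \<Longrightarrow> i < N \<Longrightarrow> Poly_Mapping.lookup e i < b"
  proof -
    have "finite (\<Union>e\<in>?K. Poly_Mapping.lookup e ` {..<N})" by simp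
    then obtain b where "(\<Union>e\<in>?K. Poly_Mapping.lookup e ` {..<N}) \<subseteq> {..<b}"
      using finite_nat_iff_bounded by blast
    then show ?thesis using that by blast
  qed
  define \<phi> where "\<phi> e = (\<Sum>i<N. Poly_Mapping.lookup e i * b ^ i)" for e :: "nat \<Rightarrow>\<^sub>0 nat"
  have inj: "e = f" if "e \<in> ?K" "f \<in> ?K" "\<phi> e = \<phi> f" for e f
  proof (rule poly_mapping_eqI)
    fix i
    have "\<forall>i<N. Poly_Mapping.lookup e i = Poly_Mapping.lookup f i"
      by (rule base_expansion_inj[of _ _ b]) (use that b in \<open>auto simp: \<phi>_def\<close>)
    moreover have "Poly_Mapping.lookup e i = 0 \<and> Poly_Mapping.lookup f i = 0" if "\<not> i < N"
      using N[OF \<open>e \<in> ?K\<close>] N[OF \<open>f \<in> ?K\<close>] that by (auto simp: in_keys_iff)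
    ultimately show "Poly_Mapping.lookup e i = Poly_Mapping.lookup f i" by (cases "i < N") auto
  qed
  define u where "u = (\<Sum>e\<in>?K. monom (Poly_Mapping.lookup q e) (\<phi> e))"
  have "poly u t = 0" for t
  proof -
    have "monom_eval e (\<lambda>i. t ^ (b ^ i)) = t ^ \<phi> e" if "e \<in> ?K" for e
      using monom_eval_superset[OF _ N[OF that]]
      by (simp add: \<phi>_def power_sum mult.commute flip: power_mult)
    then have "poly u t = eval_mpoly q (\<lambda>i. t ^ (b ^ i))"
      by (simp add: u_def poly_sum poly_monom eval_mpoly_monom_eval)
    then show ?thesis using assms by simp
  qed
  then have "u = 0" using poly_all_0_iff_0 by blast
  have "?K = {}"
  proof (rule ccontr)
    assume "?K \<noteq> {}"
    then obtain f where f: "f \<in> ?K" by blast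
    have "coeff u (\<phi> f) = (\<Sum>e\<in>?K. if e = f then Poly_Mapping.lookup q e else 0)"
      unfolding u_def coeff_sum using f inj by (intro sum.cong) auto
    also have "\<dots> = Poly_Mapping.lookup q f" using f by simp
    finally show False using \<open>u = 0\<close> f by (simp add: in_keys_iff)
  qed
  then show ?thesis by simp
qed

lemma mpoly_eqI:
  assumes "\<And>x. eval_mpoly p x = eval_mpoly q x"
  shows "p = q"
  using eval_mpoly_eq_0_imp[of "p - q"] assms by simp

section \<open>Polynomials in the first N variables and forms\<close>

lemma mpolys_zero [simp]: "0 \<in> mpolys N"
  by (simp add: mpolys_def)

lemma mpolys_Const [simp]: "Const c \<in> mpolys N"
  by (simp add: mpolys_def Const_def)

lemma mpolys_one [simp]: "1 \<in> mpolys N"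
  by (simp flip: Const_one)

lemma mpolys_Var: "i < N \<Longrightarrow> Var i \<in> mpolys N"
  by (simp add: mpolys_def Var_def)

lemma mpolys_add: "p \<in> mpolys N \<Longrightarrow> q \<in> mpolys N \<Longrightarrow> p + q \<in> mpolys N"
  using Poly_Mapping.keys_add[of p q] by (auto simp: mpolys_def)

lemma mpolys_diff: "p \<in> mpolys N \<Longrightarrow> q \<in> mpolys N \<Longrightarrow> p - q \<in> mpolys N"
  using Poly_Mapping.keys_diff[of p q] by (auto simp: mpolys_def)

lemma mpolys_mult:
  assumes "p \<in> mpolys N" "q \<in> mpolys N"
  shows "p * q \<in> mpolys N"
  unfolding mpolys_def
proof (intro CollectI ballI)
  fix e assume "e \<in> Poly_Mapping.keys (p * q)"
  then obtain a b where "e = a + b" "a \<in> Poly_Mapping.keys p" "b \<in> Poly_Mapping.keys q"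
    using keys_mult[of p q] by blast
  then show "Poly_Mapping.keys e \<subseteq> {..<N}"
    using assms Poly_Mapping.keys_add[of a b] unfolding mpolys_def by blast
qed

lemma mpolys_power: "p \<in> mpolys N \<Longrightarrow> p ^ k \<in> mpolys N"
  by (induction k) (auto intro: mpolys_mult)

lemma mpolys_sum: "(\<And>i. i \<in> I \<Longrightarrow> q i \<in> mpolys N) \<Longrightarrow> (\<Sum>i\<in>I. q i) \<in> mpolys N"
  by (induction I rule: infinite_finite_induct) (auto intro: mpolys_add)

lemma mpolys_prod: "(\<And>i. i \<in> I \<Longrightarrow> q i \<in> mpolys N) \<Longrightarrow> (\<Prod>i\<in>I. q i) \<in> mpolys N"
  by (induction I rule: infinite_finite_induct) (auto intro: mpolys_mult)

lemma mpolys_sq_norm: "sq_norm N \<in> mpolys N"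
  unfolding sq_norm_def by (auto intro!: mpolys_sum mpolys_power mpolys_Var)

lemma forms_imp_mpolys: "q \<in> forms N k \<Longrightarrow> q \<in> mpolys N"
  by (simp add: forms_def)

lemma forms_zero: "0 \<in> forms N k"
  by (simp add: forms_def)

lemma forms_Const: "Const c \<in> forms N 0"
  by (simp add: forms_def Const_def mpolys_def)

lemma forms_Var: "i < N \<Longrightarrow> Var i \<in> forms N 1"
  by (simp add: forms_def mpolys_Var) (simp add: Var_def)

lemma forms_add: "p \<in> forms N k \<Longrightarrow> q \<in> forms N k \<Longrightarrow> p + q \<in> forms N k"
  using Poly_Mapping.keys_add[of p q] by (auto simp: forms_def mpolys_add)

lemma forms_diff: "p \<in> forms N k \<Longrightarrow> q \<in> forms N k \<Longrightarrow> p - q \<in> forms N k"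
  using Poly_Mapping.keys_diff[of p q] by (auto simp: forms_def mpolys_diff)

lemma forms_mult:
  assumes "p \<in> forms N j" "q \<in> forms N k"
  shows "p * q \<in> forms N (j + k)"
  unfolding forms_def
proof (intro CollectI conjI ballI)
  show "p * q \<in> mpolys N" using assms by (simp add: forms_def mpolys_mult)
  fix e assume "e \<in> Poly_Mapping.keys (p * q)"
  then obtain a b where "e = a + b" "a \<in> Poly_Mapping.keys p" "b \<in> Poly_Mapping.keys q"
    using keys_mult[of p q] by blast
  then show "monom_degree e = j + k" using assms by (simp add: forms_def monom_degree_plus)
qed

lemma forms_power: "p \<in> forms N j \<Longrightarrow> p ^ k \<in> forms N (j * k)"
proof (induction k)
  case 0
  show ?case using forms_Const[of 1 N] by (simp add: Const_one)
next
  case (Suc k)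
  then show ?case using forms_mult[of p N j "p ^ k" "j * k"] by simp
qed

lemma forms_sum: "(\<And>i. i \<in> I \<Longrightarrow> q i \<in> forms N k) \<Longrightarrow> (\<Sum>i\<in>I. q i) \<in> forms N k"
  by (induction I rule: infinite_finite_induct) (auto intro: forms_add forms_zero)

lemma forms_Const_mult: "q \<in> forms N k \<Longrightarrow> Const c * q \<in> forms N k"
  using forms_mult[OF forms_Const] by fastforce

lemma forms_sq_norm: "sq_norm N \<in> forms N 2"
  unfolding sq_norm_def
  by (rule forms_sum) (use forms_power[OF forms_Var, of _ N 2] in auto)

lemma eval_form_scale:
  assumes "q \<in> forms N k"
  shows "eval_mpoly q (\<lambda>i. c * x i) = c ^ k * eval_mpoly q x"
  using assms
  by (simp add: eval_mpoly_monom_eval monom_eval_scale sum_distrib_left forms_def mult_ac)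

section \<open>Sums of squares\<close>

lemma is_sos_zero: "is_sos N 0"
  unfolding is_sos_def by (rule exI[of _ "[]"]) simp

lemma is_sos_square: "h \<in> mpolys N \<Longrightarrow> is_sos N (h ^ 2)"
  unfolding is_sos_def by (rule exI[of _ "[h]"]) simp

lemma is_sos_add: "is_sos N p \<Longrightarrow> is_sos N q \<Longrightarrow> is_sos N (p + q)"
  unfolding is_sos_def
proof (elim exE conjE)
  fix hs hs' assume "set hs \<subseteq> mpolys N" "p = (\<Sum>h\<leftarrow>hs. h ^ 2)" "set hs' \<subseteq> mpolys N" "q = (\<Sum>h\<leftarrow>hs'. h ^ 2)"
  then show "\<exists>hs. set hs \<subseteq> mpolys N \<and> p + q = (\<Sum>h\<leftarrow>hs. h ^ 2)"
    by (intro exI[of _ "hs @ hs'"]) auto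
qed

lemma is_sos_sum: "(\<And>i. i \<in> I \<Longrightarrow> is_sos N (q i)) \<Longrightarrow> is_sos N (\<Sum>i\<in>I. q i)"
  by (induction I rule: infinite_finite_induct) (auto intro: is_sos_add is_sos_zero)

lemma is_sos_sum_list: "(\<And>h. h \<in> set hs \<Longrightarrow> is_sos N (q h)) \<Longrightarrow> is_sos N (\<Sum>h\<leftarrow>hs. q h)"
  by (induction hs) (auto intro: is_sos_add is_sos_zero)

lemma is_sos_square_mult:
  assumes "h \<in> mpolys N" "is_sos N q"
  shows "is_sos N (h ^ 2 * q)"
proof -
  from assms(2) obtain hs where hs: "set hs \<subseteq> mpolys N" "q = (\<Sum>h\<leftarrow>hs. h ^ 2)"
    by (auto simp: is_sos_def)
  have "h ^ 2 * q = (\<Sum>k\<leftarrow>hs. (h * k) ^ 2)"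
    by (simp add: hs(2) sum_list_const_mult power_mult_distrib)
  then show ?thesis
    using hs(1) assms(1) by (auto intro!: is_sos_sum_list is_sos_square mpolys_mult)
qed

lemma is_sos_mult:
  assumes "is_sos N p" "is_sos N q"
  shows "is_sos N (p * q)"
proof -
  from assms(1) obtain hs where hs: "set hs \<subseteq> mpolys N" "p = (\<Sum>h\<leftarrow>hs. h ^ 2)"
    by (auto simp: is_sos_def)
  have "p * q = (\<Sum>h\<leftarrow>hs. h ^ 2 * q)"
    by (simp add: hs(2) sum_list_mult_const)
  then show ?thesis
    using hs(1) assms(2) by (auto intro!: is_sos_sum_list is_sos_square_mult)
qed

lemma is_sos_one: "is_sos N 1"
  using is_sos_square[of 1 N] by simp

lemma is_sos_Const:
  assumes "c \<ge> 0"
  shows "is_sos N (Const c)"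
proof -
  have "Const (sqrt c) ^ 2 = Const c" by (rule mpoly_eqI) (simp add: assms)
  then show ?thesis using is_sos_square[of "Const (sqrt c)" N] by simp
qed

lemma is_sos_power: "is_sos N q \<Longrightarrow> is_sos N (q ^ k)"
  by (induction k) (auto intro: is_sos_one is_sos_mult)

lemma is_sos_prod: "(\<And>i. i \<in> I \<Longrightarrow> is_sos N (q i)) \<Longrightarrow> is_sos N (\<Prod>i\<in>I. q i)"
  by (induction I rule: infinite_finite_induct) (auto intro: is_sos_one is_sos_mult)

lemma is_sos_sq_norm: "is_sos N (sq_norm N)"
  unfolding sq_norm_def by (auto intro!: is_sos_sum is_sos_square mpolys_Var)

lemma is_sos_eval_nonneg: "is_sos N q \<Longrightarrow> eval_mpoly q x \<ge> 0"
  unfolding is_sos_def by (auto simp: eval_mpoly_sum_list intro!: sum_list_nonneg)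

section \<open>Positive polynomials on a cube\<close>

text \<open>
  Points are functions on all natural numbers, of which only the first \<open>N\<close> coordinates matter;
  fixing the others to 0 makes the cube compact in the product topology.
\<close>

lemma compact_box:
  "compact {x :: nat \<Rightarrow> real. \<forall>i. x i \<in> (if i < N then {a..b} else {0})}"
proof -
  have "compactin (product_topology (\<lambda>i. euclidean) UNIV)
          (PiE UNIV (\<lambda>i. if i < N then {a..b} else {0 :: real}))"
    by (subst compactin_PiE) auto
  moreover have "PiE UNIV (\<lambda>i. if i < N then {a..b} else {0 :: real}) =
      {x. \<forall>i. x i \<in> (if i < N then {a..b} else {0})}"
    by (auto simp: PiE_def Pi_def)
  ultimately show ?thesis by (simp add: euclidean_product_topology)
qed

lemma continuous_on_eval_mpoly: "continuous_on A (eval_mpoly q)"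
proof -
  have coord: "continuous_on A (\<lambda>x :: nat \<Rightarrow> real. x i)" for i
    by (rule continuous_on_subset[OF continuous_on_product_coordinates]) simp
  have "continuous_on A (\<lambda>x. \<Prod>i\<in>I. x i ^ f i)" for I and f :: "nat \<Rightarrow> nat"
    by (rule continuous_on_prod, rule continuous_on_power, rule coord)
  then have "continuous_on A (\<lambda>x. c * (\<Prod>i\<in>I. x i ^ f i))" for c I and f :: "nat \<Rightarrow> nat"
    by (rule continuous_on_mult_left)
  then show ?thesis unfolding eval_mpoly_def by (rule continuous_on_sum)
qed

lemma eval_mpoly_box_attains_inf:
  assumes q: "q \<in> mpolys N" and "a \<le> b"
    and pos: "\<And>x. \<forall>i<N. a \<le> x i \<and> x i \<le> b \<Longrightarrow> eval_mpoly q x > 0"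
  obtains \<delta> where "\<delta> > 0" "\<And>x. \<forall>i<N. a \<le> x i \<and> x i \<le> b \<Longrightarrow> eval_mpoly q x \<ge> \<delta>"
proof -
  define B where "B = {x :: nat \<Rightarrow> real. \<forall>i. x i \<in> (if i < N then {a..b} else {0})}"
  have "(\<lambda>i. if i < N then a else 0) \<in> B" using \<open>a \<le> b\<close> by (simp add: B_def)
  then have "B \<noteq> {}" by blast
  moreover have "compact B" unfolding B_def by (rule compact_box)
  ultimately obtain x0 where x0: "x0 \<in> B" "\<forall>y\<in>B. eval_mpoly q x0 \<le> eval_mpoly q y"
    using continuous_attains_inf[OF _ _ continuous_on_eval_mpoly] by blast
  show ?thesis
  proof
    have "\<forall>i<N. a \<le> x0 i \<and> x0 i \<le> b"
    proof (intro allI impI)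
      fix i assume "i < N"
      have "x0 i \<in> (if i < N then {a..b} else {0})" using x0(1) unfolding B_def by blast
      then show "a \<le> x0 i \<and> x0 i \<le> b" using \<open>i < N\<close> by simp
    qed
    then show "eval_mpoly q x0 > 0" by (rule pos)
    fix x :: "nat \<Rightarrow> real" assume x: "\<forall>i<N. a \<le> x i \<and> x i \<le> b"
    define y where "y = (\<lambda>i. if i < N then x i else 0)"
    have "y \<in> B" using x by (simp add: y_def B_def)
    moreover have "eval_mpoly q x = eval_mpoly q y"
      by (rule eval_mpoly_cong[OF q]) (simp add: y_def)
    ultimately show "eval_mpoly q x0 \<le> eval_mpoly q x" using x0(2) by simp
  qed
qed

text \<open>
  The coefficient of \<open>t ^ j\<close> on the Bernstein polynomial
  \<open>(k choose a) * t ^ a * (1 - t) ^ (k - a)\<close>.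
\<close>

definition choose_ratio :: "nat \<Rightarrow> nat \<Rightarrow> nat \<Rightarrow> real" where
  "choose_ratio k j a = real (a choose j) / real (k choose j)"

lemma choose_ratio_Suc:
  assumes "Suc j \<le> k"
  shows "choose_ratio k (Suc j) a = choose_ratio k j a * ((real a - real j) / (real k - real j))"
proof -
  have *: "real (Suc j) * real (n choose Suc j) = real (n choose j) * (real n - real j)" for n
  proof (cases "j \<le> n")
    case True
    have "Suc j * (n choose Suc j) = (n - j) * (n choose j)"
      by (simp only: binomial_absorption binomial_absorb_comp)
    then have "real (Suc j * (n choose Suc j)) = real ((n - j) * (n choose j))" by (rule arg_cong)
    then show ?thesis using True by (simp only: of_nat_mult of_nat_diff mult.commute)
  qed (simp add: binomial_eq_0)
  have "choose_ratio k (Suc j) a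
      = (real (Suc j) * real (a choose Suc j)) / (real (Suc j) * real (k choose Suc j))"
    by (simp add: choose_ratio_def del: of_nat_Suc)
  also have "\<dots> = choose_ratio k j a * ((real a - real j) / (real k - real j))"
    unfolding * choose_ratio_def by simp
  finally show ?thesis .
qed

lemma choose_ratio_bounds:
  assumes "a \<le> k" "j \<le> k"
  shows "0 \<le> choose_ratio k j a" "choose_ratio k j a \<le> 1"
proof -
  have "(a choose j) \<le> (k choose j)" using assms by (intro binomial_right_mono)
  moreover have "(k choose j) > 0" using assms by simp
  ultimately show "0 \<le> choose_ratio k j a" "choose_ratio k j a \<le> 1"
    by (simp_all add: choose_ratio_def)
qed

text \<open>
  The ratio is the product of the numbers \<open>(a - l) / (k - l)\<close> for \<open>l < j\<close>, and each of them
  differs from \<open>a / k\<close> by at most \<open>l / k\<close> unless an earlier factor already vanished.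
\<close>

lemma choose_ratio_approx:
  assumes "a \<le> k" "j \<le> k" "0 < k"
  shows "\<bar>choose_ratio k j a - (real a / real k) ^ j\<bar> \<le> real (j ^ 2) / real k"
  using assms(2)
proof (induction j)
  case 0
  show ?case by (simp add: choose_ratio_def)
next
  case (Suc j)
  let ?\<rho> = "choose_ratio k j a" and ?s = "real a / real k"
  let ?u = "(real a - real j) / (real k - real j)"
  have s: "0 \<le> ?s" "?s \<le> 1" using assms by auto
  have \<rho>: "0 \<le> ?\<rho>" "?\<rho> \<le> 1" using choose_ratio_bounds[of a k j] assms(1) Suc.prems by auto
  have step: "\<bar>?\<rho> * (?u - ?s)\<bar> \<le> real j / real k"
  proof (cases "j \<le> a")
    case True
    have kj: "real k - real j > 0" using Suc.prems by simp
    define v where "v = (real k - real a) / (real k - real j)"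
    have "?s - ?u = (real j / real k) * v"
      using kj assms(3) by (simp add: v_def field_simps)
    moreover have "0 \<le> v" "v \<le> 1"
      using kj True assms(1) by (auto simp: v_def)
    ultimately have "0 \<le> ?s - ?u" "?s - ?u \<le> real j / real k"
      by (auto intro: mult_left_le simp del: times_divide_eq_left)
    then have "\<bar>?u - ?s\<bar> \<le> real j / real k" by linarith
    then have "?\<rho> * \<bar>?u - ?s\<bar> \<le> 1 * (real j / real k)"
      using \<rho> by (intro mult_mono) auto
    then show ?thesis using \<rho>(1) by (simp add: abs_mult)
  next
    case False
    then have "?\<rho> = 0" by (simp add: choose_ratio_def binomial_eq_0)
    then show ?thesis by simp
  qed
  have "choose_ratio k (Suc j) a - ?s ^ Suc j = (?\<rho> - ?s ^ j) * ?s + ?\<rho> * (?u - ?s)"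
    using choose_ratio_Suc[OF Suc.prems, of a] by (simp add: algebra_simps)
  also have "\<bar>\<dots>\<bar> \<le> \<bar>(?\<rho> - ?s ^ j) * ?s\<bar> + \<bar>?\<rho> * (?u - ?s)\<bar>" by (rule abs_triangle_ineq)
  also have "\<bar>(?\<rho> - ?s ^ j) * ?s\<bar> = \<bar>?\<rho> - ?s ^ j\<bar> * ?s" using s by (simp add: abs_mult)
  also have "\<bar>?\<rho> - ?s ^ j\<bar> * ?s \<le> \<bar>?\<rho> - ?s ^ j\<bar>" using s by (intro mult_left_le) auto
  also have "\<bar>?\<rho> - ?s ^ j\<bar> \<le> real (j ^ 2) / real k" using Suc by simp
  also note step
  also have "real (j ^ 2) / real k + real j / real k \<le> real ((Suc j) ^ 2) / real k"
    using assms(3) by (simp add: field_simps power2_eq_square)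
  finally show ?case by linarith
qed

text \<open>
  This is \<open>t ^ j * (t + (1 - t)) ^ (k - j)\<close> expanded by the binomial theorem.
\<close>

lemma power_eq_bernstein_sum:
  assumes "j \<le> k"
  shows "(t :: real) ^ j =
    (\<Sum>a\<le>k. choose_ratio k j a * (real (k choose a) * (t ^ a * (1 - t) ^ (k - a))))"
proof -
  have pos: "real (k choose j) > 0" using assms by simp
  have "t ^ j = t ^ j * (t + (1 - t)) ^ (k - j)" by simp
  also have "\<dots> = t ^ j * (\<Sum>b\<le>k - j. real (k - j choose b) * t ^ b * (1 - t) ^ (k - j - b))"
    by (subst binomial_ring) simp
  also have "\<dots> = (\<Sum>b\<le>k - j. real (k - j choose b) * t ^ (j + b) * (1 - t) ^ (k - (j + b)))"
    by (simp add: sum_distrib_left power_add mult_ac)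
  also have "\<dots> = (\<Sum>a=j..k. real (k - j choose (a - j)) * t ^ a * (1 - t) ^ (k - a))"
    by (rule sum.reindex_bij_witness[of _ "\<lambda>a. a - j" "\<lambda>b. j + b"]) (use assms in auto)
  also have "\<dots> = (\<Sum>a=j..k. choose_ratio k j a * (real (k choose a) * (t ^ a * (1 - t) ^ (k - a))))"
  proof (rule sum.cong)
    fix a assume a: "a \<in> {j..k}"
    then have "real (k choose a) * real (a choose j) = real (k choose j) * real (k - j choose (a - j))"
      using choose_mult[of j a k] by (simp flip: of_nat_mult)
    then have "real (k - j choose (a - j)) = choose_ratio k j a * real (k choose a)"
      using pos by (simp add: choose_ratio_def field_simps)
    then show "real (k - j choose (a - j)) * t ^ a * (1 - t) ^ (k - a) =
        choose_ratio k j a * (real (k choose a) * (t ^ a * (1 - t) ^ (k - a)))" by simp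
  qed simp
  also have "\<dots> = (\<Sum>a\<le>k. choose_ratio k j a * (real (k choose a) * (t ^ a * (1 - t) ^ (k - a))))"
    by (rule sum.mono_neutral_left) (auto simp: choose_ratio_def binomial_eq_0 not_le)
  finally show ?thesis .
qed

text \<open>
  The Bernstein coefficients of \<open>q\<close> of degree \<open>k\<close> converge to the values of \<open>q\<close> on the grid
  \<open>\<alpha> / k\<close>, uniformly in \<open>\<alpha>\<close>. As these values are bounded away from 0, the coefficients
  are positive for large \<open>k\<close>.
\<close>

lemma positive_on_unit_cube_bernstein:
  assumes q: "q \<in> mpolys N"
    and pos: "\<And>t. \<forall>i<N. 0 \<le> t i \<and> t i \<le> 1 \<Longrightarrow> eval_mpoly q t > 0"
  obtains k b where "\<And>\<alpha>. \<alpha> \<in> {..<N} \<rightarrow>\<^sub>E {..k} \<Longrightarrow> b \<alpha> \<ge> 0"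
    "\<And>t. eval_mpoly q t =
       (\<Sum>\<alpha>\<in>{..<N} \<rightarrow>\<^sub>E {..k}. b \<alpha> * (\<Prod>i<N. t i ^ \<alpha> i * (1 - t i) ^ (k - \<alpha> i)))"
proof -
  let ?K = "Poly_Mapping.keys q" and ?c = "Poly_Mapping.lookup q"
  obtain \<delta> where \<delta>: "\<delta> > 0"
    "\<And>t. \<forall>i<N. 0 \<le> t i \<and> t i \<le> 1 \<Longrightarrow> eval_mpoly q t \<ge> \<delta>"
    using eval_mpoly_box_attains_inf[OF q zero_le_one pos] by metis
  \<comment> \<open>Replacing choose ratios by powers changes no coefficient by more than \<open>C / k\<close>.\<close>
  define C where "C = (\<Sum>e\<in>?K. \<bar>?c e\<bar> * (\<Sum>i<N. real (Poly_Mapping.lookup e i ^ 2)))"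
  obtain k0 :: nat where k0: "C / \<delta> < real k0" using reals_Archimedean2 by blast
  obtain m where m: "\<And>e i. e \<in> ?K \<Longrightarrow> i < N \<Longrightarrow> Poly_Mapping.lookup e i < m"
  proof -
    have "finite (\<Union>e\<in>?K. Poly_Mapping.lookup e ` {..<N})" by simp
    then obtain m where "(\<Union>e\<in>?K. Poly_Mapping.lookup e ` {..<N}) \<subseteq> {..<m}"
      using finite_nat_iff_bounded by blast
    then show ?thesis using that by blast
  qed
  define k where "k = Suc (max k0 m)"
  have k: "k > 0" "C < \<delta> * real k" "\<And>e i. e \<in> ?K \<Longrightarrow> i < N \<Longrightarrow> Poly_Mapping.lookup e i \<le> k"
  proof -
    have "C / \<delta> < real k" using k0 by (simp add: k_def)
    then show "C < \<delta> * real k" using \<delta>(1) by (simp add: field_simps)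
    show "Poly_Mapping.lookup e i \<le> k" if "e \<in> ?K" "i < N" for e i
      using m[OF that] by (simp add: k_def)
  qed (simp add: k_def)
  define \<rho> where "\<rho> e \<alpha> = (\<Prod>i<N. choose_ratio k (Poly_Mapping.lookup e i) (\<alpha> i))" for e \<alpha>
  define b where "b \<alpha> = (\<Sum>e\<in>?K. ?c e * \<rho> e \<alpha>) * (\<Prod>i<N. real (k choose \<alpha> i))" for \<alpha>
  have monom: "monom_eval e t = (\<Prod>i<N. t i ^ Poly_Mapping.lookup e i)" if "e \<in> ?K" for e t
    using q that by (intro monom_eval_superset) (auto simp: mpolys_def)
  show ?thesis
  proof (rule that)
    fix \<alpha> assume \<alpha>: "\<alpha> \<in> {..<N} \<rightarrow>\<^sub>E {..k}"
    let ?t = "\<lambda>i. real (\<alpha> i) / real k"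
    have \<alpha>k: "\<alpha> i \<le> k" if "i < N" for i using \<alpha> that by auto
    have "\<bar>(\<Sum>e\<in>?K. ?c e * \<rho> e \<alpha>) - eval_mpoly q ?t\<bar>
        = \<bar>\<Sum>e\<in>?K. ?c e * (\<rho> e \<alpha> - monom_eval e ?t)\<bar>"
      by (simp add: eval_mpoly_monom_eval sum_subtractf algebra_simps)
    also have "\<dots> \<le> (\<Sum>e\<in>?K. \<bar>?c e\<bar> * \<bar>\<rho> e \<alpha> - monom_eval e ?t\<bar>)"
      by (rule order.trans[OF sum_abs]) (simp add: abs_mult)
    also have "\<dots> \<le> (\<Sum>e\<in>?K. \<bar>?c e\<bar> * ((\<Sum>i<N. real (Poly_Mapping.lookup e i ^ 2)) / real k))"
    proof (intro sum_mono mult_left_mono)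
      fix e assume e: "e \<in> ?K"
      have "\<bar>\<rho> e \<alpha> - monom_eval e ?t\<bar> \<le>
          (\<Sum>i<N. \<bar>choose_ratio k (Poly_Mapping.lookup e i) (\<alpha> i) - ?t i ^ Poly_Mapping.lookup e i\<bar>)"
        unfolding \<rho>_def monom[OF e] real_norm_def[symmetric]
      proof (rule norm_prod_diff)
        fix i assume "i \<in> {..<N}"
        then have i: "i < N" by simp
        show "norm (choose_ratio k (Poly_Mapping.lookup e i) (\<alpha> i)) \<le> 1"
          using choose_ratio_bounds[OF \<alpha>k[OF i] k(3)[OF e i]] by simp
        show "norm (?t i ^ Poly_Mapping.lookup e i) \<le> 1"
          using \<alpha>k[OF i] k(1) by (simp add: power_le_one)
      qed
      also have "\<dots> \<le> (\<Sum>i<N. real (Poly_Mapping.lookup e i ^ 2) / real k)"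
        by (intro sum_mono choose_ratio_approx) (use \<alpha>k k e in auto)
      finally show "\<bar>\<rho> e \<alpha> - monom_eval e ?t\<bar> \<le> (\<Sum>i<N. real (Poly_Mapping.lookup e i ^ 2)) / real k"
        by (simp add: sum_divide_distrib)
    qed auto
    also have "\<dots> = C / real k" by (simp add: C_def flip: sum_divide_distrib)
    also have "\<dots> < \<delta>" using k(1,2) by (simp add: field_simps)
    finally have "\<bar>(\<Sum>e\<in>?K. ?c e * \<rho> e \<alpha>) - eval_mpoly q ?t\<bar> < \<delta>" .
    moreover have "eval_mpoly q ?t \<ge> \<delta>" by (rule \<delta>(2)) (use \<alpha>k k(1) in auto)
    ultimately have "(\<Sum>e\<in>?K. ?c e * \<rho> e \<alpha>) \<ge> 0" by linarith
    then show "b \<alpha> \<ge> 0" by (simp add: b_def prod_nonneg)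
  next
    fix t :: "nat \<Rightarrow> real"
    let ?w = "\<lambda>\<alpha> i. t i ^ \<alpha> i * (1 - t i) ^ (k - \<alpha> i)"
    have "monom_eval e t =
        (\<Sum>\<alpha>\<in>{..<N} \<rightarrow>\<^sub>E {..k}. \<rho> e \<alpha> * ((\<Prod>i<N. real (k choose \<alpha> i)) * (\<Prod>i<N. ?w \<alpha> i)))"
      if e: "e \<in> ?K" for e
    proof -
      have "monom_eval e t = (\<Prod>i<N. \<Sum>a\<le>k. choose_ratio k (Poly_Mapping.lookup e i) a *
          (real (k choose a) * (t i ^ a * (1 - t i) ^ (k - a))))"
        unfolding monom[OF e] by (intro prod.cong refl power_eq_bernstein_sum) (use k(3) e in auto)
      also have "\<dots> = (\<Sum>\<alpha>\<in>{..<N} \<rightarrow>\<^sub>E {..k}. \<Prod>i<N. choose_ratio k (Poly_Mapping.lookup e i) (\<alpha> i) *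
          (real (k choose \<alpha> i) * ?w \<alpha> i))"
        by (rule prod_sum_PiE) auto
      finally show ?thesis by (simp add: prod.distrib \<rho>_def)
    qed
    then have "eval_mpoly q t = (\<Sum>e\<in>?K. \<Sum>\<alpha>\<in>{..<N} \<rightarrow>\<^sub>E {..k}.
        ?c e * (\<rho> e \<alpha> * ((\<Prod>i<N. real (k choose \<alpha> i)) * (\<Prod>i<N. ?w \<alpha> i))))"
      by (simp add: eval_mpoly_monom_eval sum_distrib_left)
    also have "\<dots> = (\<Sum>\<alpha>\<in>{..<N} \<rightarrow>\<^sub>E {..k}. b \<alpha> * (\<Prod>i<N. ?w \<alpha> i))"
      by (subst sum.swap) (simp add: b_def sum_distrib_right sum_distrib_left mult_ac)
    finally show "eval_mpoly q t = (\<Sum>\<alpha>\<in>{..<N} \<rightarrow>\<^sub>E {..k}. b \<alpha> * (\<Prod>i<N. ?w \<alpha> i))" .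
  qed
qed

section \<open>Positive polynomials on a sphere\<close>

lemma mpolys_substitute:
  assumes "q \<in> mpolys n" "\<And>i. i < n \<Longrightarrow> L i \<in> mpolys N"
  obtains q' where "q' \<in> mpolys N" "\<And>x. eval_mpoly q' x = eval_mpoly q (\<lambda>i. eval_mpoly (L i) x)"
proof
  let ?q = "\<Sum>e\<in>Poly_Mapping.keys q. Const (Poly_Mapping.lookup q e) *
      (\<Prod>i\<in>Poly_Mapping.keys e. L i ^ Poly_Mapping.lookup e i)"
  have "i < n" if "e \<in> Poly_Mapping.keys q" "i \<in> Poly_Mapping.keys e" for e i
    using assms(1) that by (auto simp: mpolys_def)
  then show "?q \<in> mpolys N"
    by (auto intro!: mpolys_sum mpolys_mult mpolys_prod mpolys_power assms(2))
  show "eval_mpoly ?q x = eval_mpoly q (\<lambda>i. eval_mpoly (L i) x)" for x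
    by (simp add: eval_mpoly_def[of q])
qed

text \<open>
  The added term vanishes on the sphere and is bounded below by a positive number on the
  compact part of the cube where \<open>q \<le> 0\<close>; a large \<open>M\<close> outweighs the minimum of \<open>q\<close>.
\<close>

lemma positive_on_sphere_imp_on_cube:
  assumes q: "q \<in> mpolys N"
    and pos: "\<And>x. (\<Sum>i<N. x i ^ 2) = 1 \<Longrightarrow> eval_mpoly q x > 0"
  obtains M where "\<And>x. \<forall>i<N. - 1 \<le> x i \<and> x i \<le> 1 \<Longrightarrow>
    eval_mpoly (q + Const M * (1 - sq_norm N) ^ 2) x > 0"
proof -
  let ?B = "{x :: nat \<Rightarrow> real. \<forall>i. x i \<in> (if i < N then {- 1..1} else {0})}"
  let ?w = "(1 - sq_norm N) ^ 2"
  define K where "K = ?B \<inter> {x. eval_mpoly q x \<le> 0}"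
  have "closed {x. eval_mpoly q x \<le> 0}"
    by (intro closed_Collect_le continuous_on_eval_mpoly continuous_on_const)
  then have K: "compact K" unfolding K_def by (intro compact_Int_closed compact_box)
  have "\<exists>M. \<forall>x\<in>?B. eval_mpoly (q + Const M * ?w) x > 0"
  proof (cases "K = {}")
    case True
    have "eval_mpoly q x > 0" if "x \<in> ?B" for x
    proof (rule ccontr)
      assume "\<not> eval_mpoly q x > 0"
      then have "x \<in> K" unfolding K_def using that by (intro IntI) auto
      then show False using True by simp
    qed
    then show ?thesis by (intro exI[of _ 0]) simp
  next
    case False
    obtain x1 where x1: "x1 \<in> K" "\<forall>x\<in>K. eval_mpoly ?w x1 \<le> eval_mpoly ?w x"
      using continuous_attains_inf[OF K False continuous_on_eval_mpoly] by blast
    have "?B \<noteq> {}" using False unfolding K_def by blast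
    then obtain x0 where x0: "\<forall>x\<in>?B. eval_mpoly q x0 \<le> eval_mpoly q x"
      using continuous_attains_inf[OF compact_box _ continuous_on_eval_mpoly] by blast
    let ?\<delta> = "eval_mpoly ?w x1"
    have "(\<Sum>i<N. x1 i ^ 2) \<noteq> 1" using x1(1) pos[of x1] by (auto simp: K_def)
    then have \<delta>: "?\<delta> > 0" by simp
    define M where "M = (1 + \<bar>eval_mpoly q x0\<bar>) / ?\<delta>"
    have "M \<ge> 0" using \<delta> by (simp add: M_def)
    have "eval_mpoly (q + Const M * ?w) x > 0" if x: "x \<in> ?B" for x
    proof (cases "eval_mpoly q x \<le> 0")
      case True
      then have "?\<delta> \<le> eval_mpoly ?w x" using x1(2) x by (simp add: K_def)
      then have "M * ?\<delta> \<le> M * eval_mpoly ?w x" using \<open>M \<ge> 0\<close> by (rule mult_left_mono)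
      moreover have "M * ?\<delta> = 1 + \<bar>eval_mpoly q x0\<bar>" using \<delta> by (simp add: M_def)
      moreover have "eval_mpoly q x0 \<le> eval_mpoly q x" using x0 x by blast
      ultimately show ?thesis by (simp del: eval_mpoly_power)
    next
      case False
      moreover have "M * eval_mpoly ?w x \<ge> 0" using \<open>M \<ge> 0\<close> by simp
      ultimately show ?thesis by (simp del: eval_mpoly_power)
    qed
    then show ?thesis by blast
  qed
  then obtain M where M: "\<forall>x\<in>?B. eval_mpoly (q + Const M * ?w) x > 0" by blast
  have poly: "q + Const M * ?w \<in> mpolys N"
    using q by (intro mpolys_add mpolys_mult mpolys_power mpolys_diff mpolys_sq_norm) auto
  show ?thesis
  proof (rule that)
    fix x :: "nat \<Rightarrow> real" assume x: "\<forall>i<N. - 1 \<le> x i \<and> x i \<le> 1"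
    let ?y = "\<lambda>i. if i < N then x i else 0"
    have "?y \<in> ?B" using x by auto
    then have "eval_mpoly (q + Const M * ?w) ?y > 0" using M by blast
    also have "eval_mpoly (q + Const M * ?w) ?y = eval_mpoly (q + Const M * ?w) x"
      by (rule eval_mpoly_cong[OF poly]) simp
    finally show "eval_mpoly (q + Const M * ?w) x > 0" .
  qed
qed

text \<open>
  The minimum is taken over the cube, of a polynomial that is positive there and agrees with
  \<open>q\<close> on the sphere.
\<close>

lemma positive_on_sphere_bounded_below:
  assumes q: "q \<in> mpolys N" and pos: "\<And>x. (\<Sum>i<N. x i ^ 2) = 1 \<Longrightarrow> eval_mpoly q x > 0"
  obtains \<delta> where "\<delta> > 0" "\<And>x. (\<Sum>i<N. x i ^ 2) = 1 \<Longrightarrow> eval_mpoly q x \<ge> \<delta>"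
proof -
  obtain M where M: "\<And>x. \<forall>i<N. - 1 \<le> x i \<and> x i \<le> 1 \<Longrightarrow>
      eval_mpoly (q + Const M * (1 - sq_norm N) ^ 2) x > 0"
    using positive_on_sphere_imp_on_cube[OF q pos] by metis
  have q1: "q + Const M * (1 - sq_norm N) ^ 2 \<in> mpolys N"
    using q by (intro mpolys_add mpolys_mult mpolys_power mpolys_diff mpolys_sq_norm) auto
  have "(- 1 :: real) \<le> 1" by simp
  from eval_mpoly_box_attains_inf[OF q1 this M]
  obtain \<delta> where \<delta>: "\<delta> > 0" "\<And>x. \<forall>i<N. - 1 \<le> x i \<and> x i \<le> 1 \<Longrightarrow>
      eval_mpoly (q + Const M * (1 - sq_norm N) ^ 2) x \<ge> \<delta>"
    by metis
  show ?thesis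
  proof (rule that[OF \<delta>(1)])
    fix x :: "nat \<Rightarrow> real" assume x: "(\<Sum>i<N. x i ^ 2) = 1"
    have "- 1 \<le> x i \<and> x i \<le> 1" if "i < N" for i
    proof -
      have "x i ^ 2 \<le> 1"
        using member_le_sum[of i "{..<N}" "\<lambda>i. x i ^ 2"] that x by simp
      then show ?thesis using abs_square_le_1[of "x i"] by auto
    qed
    then show "eval_mpoly q x \<ge> \<delta>" using \<delta>(2)[of x] x by simp
  qed
qed

text \<open>
  On the sphere, \<open>(1 + \<epsilon> * x i) ^ 2\<close> and the squares of the other coordinates add up to
  \<open>2 * (1 + \<epsilon> * x i)\<close>.
\<close>

lemma affine_factor_sos_on_sphere:
  assumes "i < N" "\<epsilon> ^ 2 = 1"
  obtains s where "is_sos N s"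
    "\<And>x. (\<Sum>i<N. x i ^ 2) = 1 \<Longrightarrow> eval_mpoly s x = (1 + \<epsilon> * x i) / 2"
proof
  let ?s = "Const (1 / 4) * ((1 + Const \<epsilon> * Var i) ^ 2 + (\<Sum>j\<in>{..<N} - {i}. Var j ^ 2))"
  show "is_sos N ?s"
    using assms(1)
    by (intro is_sos_mult is_sos_Const is_sos_add is_sos_sum is_sos_square mpolys_add mpolys_mult)
       (auto intro: mpolys_Var)
  fix x :: "nat \<Rightarrow> real" assume x: "(\<Sum>i<N. x i ^ 2) = 1"
  have "(\<Sum>j\<in>{..<N} - {i}. x j ^ 2) = 1 - x i ^ 2"
    using x sum.remove[of "{..<N}" i "\<lambda>j. x j ^ 2"] assms(1) by simp
  moreover have "(1 + \<epsilon> * x i) ^ 2 = 1 + 2 * (\<epsilon> * x i) + x i ^ 2"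
    using assms(2) by (simp add: power2_sum power_mult_distrib)
  ultimately show "eval_mpoly ?s x = (1 + \<epsilon> * x i) / 2" by simp
qed

text \<open>
  The Bernstein expansion on the cube is a combination, with nonnegative coefficients, of
  products of affine functions that are sums of squares on the sphere.
\<close>

lemma positive_on_sphere_imp_sos_on_sphere:
  assumes q: "q \<in> mpolys N"
    and pos: "\<And>x. (\<Sum>i<N. x i ^ 2) = 1 \<Longrightarrow> eval_mpoly q x > 0"
  obtains s where "is_sos N s" "\<And>x. (\<Sum>i<N. x i ^ 2) = 1 \<Longrightarrow> eval_mpoly q x = eval_mpoly s x"
proof -
  obtain M where M: "\<And>x. \<forall>i<N. - 1 \<le> x i \<and> x i \<le> 1 \<Longrightarrow>
      eval_mpoly (q + Const M * (1 - sq_norm N) ^ 2) x > 0"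
    using positive_on_sphere_imp_on_cube[OF q pos] by blast
  let ?q1 = "q + Const M * (1 - sq_norm N) ^ 2"
  have q1: "?q1 \<in> mpolys N"
    using q by (intro mpolys_add mpolys_mult mpolys_power mpolys_diff mpolys_sq_norm) auto
  \<comment> \<open>Bernstein expansions live on \<open>[0, 1]\<close>, so the cube \<open>[-1, 1]\<close> is rescaled.\<close>
  obtain q2 where q2: "q2 \<in> mpolys N"
    "\<And>t. eval_mpoly q2 t = eval_mpoly ?q1 (\<lambda>i. eval_mpoly (Const 2 * Var i - 1) t)"
  proof (rule mpolys_substitute[OF q1])
    show "Const 2 * Var i - 1 \<in> mpolys N" if "i < N" for i
      using that by (intro mpolys_diff mpolys_mult mpolys_Var) auto
  qed blast
  have "eval_mpoly q2 t > 0" if "\<forall>i<N. 0 \<le> t i \<and> t i \<le> 1" for t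
    unfolding q2(2) by (rule M) (use that in auto)
  then obtain k b where b: "\<And>\<alpha>. \<alpha> \<in> {..<N} \<rightarrow>\<^sub>E {..k} \<Longrightarrow> b \<alpha> \<ge> 0"
    "\<And>t. eval_mpoly q2 t =
       (\<Sum>\<alpha>\<in>{..<N} \<rightarrow>\<^sub>E {..k}. b \<alpha> * (\<Prod>i<N. t i ^ \<alpha> i * (1 - t i) ^ (k - \<alpha> i)))"
    using positive_on_unit_cube_bernstein[OF q2(1)] by blast
  have factors: "\<exists>w. \<forall>i\<in>{..<N}. is_sos N (w i) \<and>
      (\<forall>x. (\<Sum>i<N. x i ^ 2) = 1 \<longrightarrow> eval_mpoly (w i) x = (1 + \<epsilon> * x i) / 2)"
    if "\<epsilon> ^ 2 = 1" for \<epsilon> :: real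
  proof (rule bchoice, rule ballI)
    fix i assume "i \<in> {..<N}"
    then show "\<exists>s. is_sos N s \<and>
        (\<forall>x. (\<Sum>i<N. x i ^ 2) = 1 \<longrightarrow> eval_mpoly s x = (1 + \<epsilon> * x i) / 2)"
      using affine_factor_sos_on_sphere[of i N \<epsilon>] that by blast
  qed
  obtain u where "\<forall>i\<in>{..<N}. is_sos N (u i) \<and>
      (\<forall>x. (\<Sum>i<N. x i ^ 2) = 1 \<longrightarrow> eval_mpoly (u i) x = (1 + 1 * x i) / 2)"
    using factors[of 1] by auto
  then have u: "\<And>i. i < N \<Longrightarrow> is_sos N (u i)"
    "\<And>i x. i < N \<Longrightarrow> (\<Sum>i<N. x i ^ 2) = 1 \<Longrightarrow> eval_mpoly (u i) x = (1 + x i) / 2"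
    by auto
  obtain v where "\<forall>i\<in>{..<N}. is_sos N (v i) \<and>
      (\<forall>x. (\<Sum>i<N. x i ^ 2) = 1 \<longrightarrow> eval_mpoly (v i) x = (1 + - 1 * x i) / 2)"
    using factors[of "- 1"] by auto
  then have v: "\<And>i. i < N \<Longrightarrow> is_sos N (v i)"
    "\<And>i x. i < N \<Longrightarrow> (\<Sum>i<N. x i ^ 2) = 1 \<Longrightarrow> eval_mpoly (v i) x = (1 - x i) / 2"
    by auto
  let ?s = "\<Sum>\<alpha>\<in>{..<N} \<rightarrow>\<^sub>E {..k}. Const (b \<alpha>) * (\<Prod>i<N. u i ^ \<alpha> i * v i ^ (k - \<alpha> i))"
  show ?thesis
  proof
    show "is_sos N ?s"
      using b(1) u(1) v(1) by (auto intro!: is_sos_sum is_sos_mult is_sos_Const is_sos_prod is_sos_power)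
    fix x :: "nat \<Rightarrow> real" assume x: "(\<Sum>i<N. x i ^ 2) = 1"
    have "eval_mpoly q2 (\<lambda>i. (1 + x i) / 2) = eval_mpoly ?s x"
      unfolding b(2)
    proof (simp add: u(2)[OF _ x] v(2)[OF _ x], intro sum.cong prod.cong arg_cong2[where f = "(*)"] refl)
      show "(1 - (1 + x i) / 2) ^ j = ((1 - x i) / 2) ^ j" for i j
        by (rule arg_cong[of _ _ "\<lambda>z. z ^ j"]) (simp add: field_simps)
    qed
    moreover have "(\<lambda>i. eval_mpoly (Const 2 * Var i - 1) (\<lambda>i. (1 + x i) / 2)) = x"
      by (rule ext) (simp add: field_simps)
    then have "eval_mpoly q2 (\<lambda>i. (1 + x i) / 2) = eval_mpoly ?q1 x"
      by (simp only: q2(2))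
    moreover have "eval_mpoly ?q1 x = eval_mpoly q x" using x by simp
    ultimately show "eval_mpoly q x = eval_mpoly ?s x" by simp
  qed
qed

section \<open>Uniform denominators for positive definite forms\<close>

text \<open>
  For \<open>x = c * u\<close> with \<open>c = \<bar>x\<bar>\<close> the right-hand side is \<open>\<bar>x\<bar>\<^sup>2\<^sup>E\<close> times twice the even part
  of \<open>h\<close> at \<open>x / \<bar>x\<bar>\<close>. A monomial of even degree \<open>k\<close> contributes a multiple of itself times
  \<open>\<bar>x\<bar>\<^sup>2\<^sup>E\<^sup>-\<^sup>k\<close>, an even power of \<open>\<bar>x\<bar>\<close> and thus a polynomial; monomials of odd degree cancel.
\<close>

lemma even_part_homogenization:
  assumes h: "h \<in> mpolys N"
  obtains E0 where "\<And>E. E \<ge> E0 \<Longrightarrow> \<exists>A\<in>mpolys N. \<forall>u c. (\<Sum>i<N. u i ^ 2) = 1 \<longrightarrow>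
    eval_mpoly A (\<lambda>i. c * u i) = c ^ (2 * E) * (eval_mpoly h u + eval_mpoly h (\<lambda>i. - u i))"
proof
  fix E assume E: "E \<ge> total_degree h"
  let ?K = "Poly_Mapping.keys h"
  define T where "T e = (if even (monom_degree e)
      then Const (2 * Poly_Mapping.lookup h e) * Poly_Mapping.single e 1 * sq_norm N ^ (E - monom_degree e div 2)
      else 0)" for e
  show "\<exists>A\<in>mpolys N. \<forall>u c. (\<Sum>i<N. u i ^ 2) = 1 \<longrightarrow>
    eval_mpoly A (\<lambda>i. c * u i) = c ^ (2 * E) * (eval_mpoly h u + eval_mpoly h (\<lambda>i. - u i))"
  proof (intro bexI[of _ "\<Sum>e\<in>?K. T e"] allI impI)
    have "Poly_Mapping.single e (1 :: real) \<in> mpolys N" if "e \<in> ?K" for e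
      using h that by (simp add: mpolys_def)
    then show "(\<Sum>e\<in>?K. T e) \<in> mpolys N"
      by (auto simp: T_def intro!: mpolys_sum mpolys_mult mpolys_power mpolys_sq_norm)
    fix u :: "nat \<Rightarrow> real" and c :: real assume u: "(\<Sum>i<N. u i ^ 2) = 1"
    have "eval_mpoly (T e) (\<lambda>i. c * u i) =
        c ^ (2 * E) * (Poly_Mapping.lookup h e * (monom_eval e u + monom_eval e (\<lambda>i. - u i)))"
      if e: "e \<in> ?K" for e
    proof -
      have neg: "monom_eval e (\<lambda>i. - u i) = (- 1) ^ monom_degree e * monom_eval e u"
        using monom_eval_scale[of e "- 1" u] by simp
      show ?thesis
      proof (cases "even (monom_degree e)")
        case True
        have "monom_degree e \<le> total_degree h"
          unfolding total_degree_def using e by (intro Max_ge) auto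
        then have "monom_degree e + 2 * (E - monom_degree e div 2) = 2 * E"
          using E True by (auto elim!: evenE)
        then have "c ^ monom_degree e * (c ^ 2) ^ (E - monom_degree e div 2) = c ^ (2 * E)"
          by (metis power_add power_mult)
        moreover have "(\<Sum>i<N. (c * u i) ^ 2) = c ^ 2"
          using u by (simp add: power_mult_distrib flip: sum_distrib_left)
        ultimately show ?thesis
          using True neg by (simp add: T_def monom_eval_scale mult_ac)
      next
        case False
        then show ?thesis using neg by (simp add: T_def)
      qed
    qed
    then show "eval_mpoly (\<Sum>e\<in>?K. T e) (\<lambda>i. c * u i) =
        c ^ (2 * E) * (eval_mpoly h u + eval_mpoly h (\<lambda>i. - u i))"
      by (simp add: eval_mpoly_monom_eval[of h] sum_distrib_left ring_distribs sum.distrib)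
  qed
qed

text \<open>
  With \<open>a = h(u)\<close> and \<open>b = h(-u)\<close> one has \<open>a\<^sup>2 + b\<^sup>2 = ((a + b)\<^sup>2 + (a - b)\<^sup>2) / 2\<close>, and on the
  sphere \<open>(a - b)\<^sup>2\<close> is the sum of the squares of \<open>u\<^sub>i * (a - b)\<close>. Here \<open>u\<^sub>i * (a - b)\<close> is twice
  the even part of \<open>x\<^sub>i * h\<close> at \<open>u\<close>, so that only even parts have to be homogenized.
\<close>

lemma square_even_odd_homogenization:
  assumes h: "h \<in> mpolys N"
  obtains E0 where "\<And>E. E \<ge> E0 \<Longrightarrow> \<exists>s. is_sos N s \<and> (\<forall>u c. (\<Sum>i<N. u i ^ 2) = 1 \<longrightarrow>
    eval_mpoly s (\<lambda>i. c * u i) = c ^ (4 * E) * (eval_mpoly h u ^ 2 + eval_mpoly h (\<lambda>i. - u i) ^ 2))"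
proof -
  let ?P = "\<lambda>h E A. A \<in> mpolys N \<and> (\<forall>u c. (\<Sum>i<N. u i ^ 2) = 1 \<longrightarrow>
    eval_mpoly A (\<lambda>i. c * u i) = c ^ (2 * E) * (eval_mpoly h u + eval_mpoly h (\<lambda>i. - u i)))"
  obtain e0 where e0: "\<And>E. E \<ge> e0 \<Longrightarrow> \<exists>A. ?P h E A"
    using even_part_homogenization[OF h] by metis
  have "\<forall>i\<in>{..<N}. \<exists>e. \<forall>E\<ge>e. \<exists>A. ?P (Var i * h) E A"
  proof
    fix i assume "i \<in> {..<N}"
    then have "Var i * h \<in> mpolys N" using h by (simp add: mpolys_mult mpolys_Var)
    then show "\<exists>e. \<forall>E\<ge>e. \<exists>A. ?P (Var i * h) E A"
      using even_part_homogenization[of "Var i * h" N] by metis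
  qed
  then obtain e where e: "\<And>i E. i < N \<Longrightarrow> E \<ge> e i \<Longrightarrow> \<exists>A. ?P (Var i * h) E A"
    unfolding bchoice_iff by (metis lessThan_iff)
  show ?thesis
  proof
    fix E assume E: "E \<ge> e0 + (\<Sum>i<N. e i)"
    obtain A where A: "?P h E A" using e0[of E] E by auto
    have "e i \<le> E" if "i < N" for i
      using member_le_sum[of i "{..<N}" e] that E by simp
    then have "\<forall>i\<in>{..<N}. \<exists>A. ?P (Var i * h) E A" using e by simp
    then obtain B where B: "\<And>i. i < N \<Longrightarrow> ?P (Var i * h) E (B i)"
      unfolding bchoice_iff by (metis lessThan_iff)
    let ?s = "Const (1 / 2) * (A ^ 2 + (\<Sum>i<N. B i ^ 2))"
    show "\<exists>s. is_sos N s \<and> (\<forall>u c. (\<Sum>i<N. u i ^ 2) = 1 \<longrightarrow>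
      eval_mpoly s (\<lambda>i. c * u i) = c ^ (4 * E) * (eval_mpoly h u ^ 2 + eval_mpoly h (\<lambda>i. - u i) ^ 2))"
    proof (intro exI[of _ ?s] conjI allI impI)
      show "is_sos N ?s"
        using A B by (auto intro!: is_sos_mult is_sos_add is_sos_sum is_sos_square is_sos_Const)
      fix u :: "nat \<Rightarrow> real" and c :: real assume u: "(\<Sum>i<N. u i ^ 2) = 1"
      let ?a = "eval_mpoly h u" and ?b = "eval_mpoly h (\<lambda>i. - u i)"
      have cE: "(c ^ (2 * E)) ^ 2 = c ^ (4 * E)" by (simp flip: power_mult)
      have "(\<Sum>i<N. eval_mpoly (B i) (\<lambda>i. c * u i) ^ 2) = (\<Sum>i<N. u i ^ 2 * (c ^ (4 * E) * (?a - ?b) ^ 2))"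
      proof (rule sum.cong)
        fix i assume "i \<in> {..<N}"
        then have "eval_mpoly (B i) (\<lambda>i. c * u i) = c ^ (2 * E) * (u i * (?a - ?b))"
          using B[of i] u by (simp add: algebra_simps)
        then show "eval_mpoly (B i) (\<lambda>i. c * u i) ^ 2 = u i ^ 2 * (c ^ (4 * E) * (?a - ?b) ^ 2)"
          by (simp add: power_mult_distrib cE)
      qed simp
      also have "\<dots> = c ^ (4 * E) * (?a - ?b) ^ 2"
        using u by (simp flip: sum_distrib_right)
      finally have "(\<Sum>i<N. eval_mpoly (B i) (\<lambda>i. c * u i) ^ 2) = c ^ (4 * E) * (?a - ?b) ^ 2" .
      moreover have "eval_mpoly A (\<lambda>i. c * u i) ^ 2 = c ^ (4 * E) * (?a + ?b) ^ 2"
        using A u by (simp add: power_mult_distrib cE)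
      ultimately show "eval_mpoly ?s (\<lambda>i. c * u i) = c ^ (4 * E) * (?a ^ 2 + ?b ^ 2)"
        by (simp add: power2_sum power2_diff algebra_simps)
    qed
  qed
qed

text \<open>
  The threshold on \<open>E\<close> instead of a single exponent lets the summands of \<open>s\<close> share one \<open>E\<close>.
\<close>

lemma sos_homogenization:
  assumes "is_sos N s"
  obtains E0 where "\<And>E. E \<ge> E0 \<Longrightarrow> \<exists>s'. is_sos N s' \<and> (\<forall>u c. (\<Sum>i<N. u i ^ 2) = 1 \<longrightarrow>
    eval_mpoly s' (\<lambda>i. c * u i) = c ^ (4 * E) * (eval_mpoly s u + eval_mpoly s (\<lambda>i. - u i)))"
proof -
  from assms obtain hs where hs: "set hs \<subseteq> mpolys N" and s: "s = (\<Sum>h\<leftarrow>hs. h ^ 2)"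
    by (auto simp: is_sos_def)
  have "\<exists>E0. \<forall>E\<ge>E0. \<exists>s'. is_sos N s' \<and> (\<forall>u c. (\<Sum>i<N. u i ^ 2) = 1 \<longrightarrow>
    eval_mpoly s' (\<lambda>i. c * u i) =
      c ^ (4 * E) * (eval_mpoly (\<Sum>h\<leftarrow>hs. h ^ 2) u + eval_mpoly (\<Sum>h\<leftarrow>hs. h ^ 2) (\<lambda>i. - u i)))"
    using hs
  proof (induction hs)
    case Nil
    show ?case by (intro exI[of _ 0] allI impI) (auto intro!: exI[of _ 0] is_sos_zero)
  next
    case (Cons h hs)
    let ?Q = "\<lambda>s E s'. is_sos N s' \<and> (\<forall>u c. (\<Sum>i<N. u i ^ 2) = 1 \<longrightarrow>
      eval_mpoly s' (\<lambda>i. c * u i) = c ^ (4 * E) * (eval_mpoly s u + eval_mpoly s (\<lambda>i. - u i)))"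
    obtain E1 where E1: "\<And>E. E \<ge> E1 \<Longrightarrow> \<exists>s'. ?Q (h ^ 2) E s'"
      using square_even_odd_homogenization[of h N] Cons.prems by (auto simp del: eval_mpoly_sum)
    obtain E2 where E2: "\<And>E. E \<ge> E2 \<Longrightarrow> \<exists>s'. ?Q (\<Sum>h\<leftarrow>hs. h ^ 2) E s'"
      using Cons by auto
    show ?case
    proof (intro exI[of _ "E1 + E2"] allI impI)
      fix E assume "E1 + E2 \<le> E"
      then obtain s1 s2 where "?Q (h ^ 2) E s1" "?Q (\<Sum>h\<leftarrow>hs. h ^ 2) E s2"
        using E1[of E] E2[of E] by auto
      then show "\<exists>s'. ?Q (\<Sum>h\<leftarrow>h # hs. h ^ 2) E s'"
        by (intro exI[of _ "s1 + s2"]) (auto simp: is_sos_add algebra_simps)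
    qed
  qed
  then show ?thesis using that s by blast
qed

text \<open>
  Reznick's theorem. On the sphere \<open>q\<close> agrees with a sum of squares \<open>s\<close>; as \<open>q\<close> has
  even degree, it also agrees with \<open>(s(u) + s(-u)) / 2\<close>, which becomes a polynomial sum of
  squares after multiplication with a power of \<open>\<bar>x\<bar>\<^sup>2\<close>.
\<close>

lemma positive_definite_form_uniform_denominator:
  assumes q: "q \<in> forms N (2 * k)"
    and pos: "\<And>x. (\<Sum>i<N. x i ^ 2) = 1 \<Longrightarrow> eval_mpoly q x > 0"
  obtains r where "is_sos N (q * sq_norm N ^ r)"
proof -
  obtain s where s: "is_sos N s" "\<And>x. (\<Sum>i<N. x i ^ 2) = 1 \<Longrightarrow> eval_mpoly q x = eval_mpoly s x"
    using positive_on_sphere_imp_sos_on_sphere[OF forms_imp_mpolys[OF q] pos] by blast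
  obtain E0 where E0: "\<And>E. E \<ge> E0 \<Longrightarrow> \<exists>s'. is_sos N s' \<and> (\<forall>u c. (\<Sum>i<N. u i ^ 2) = 1 \<longrightarrow>
    eval_mpoly s' (\<lambda>i. c * u i) = c ^ (4 * E) * (eval_mpoly s u + eval_mpoly s (\<lambda>i. - u i)))"
    using sos_homogenization[OF s(1)] by blast
  define E where "E = E0 + k"
  obtain s' where s': "is_sos N s'" "\<And>u c. (\<Sum>i<N. u i ^ 2) = 1 \<Longrightarrow>
    eval_mpoly s' (\<lambda>i. c * u i) = c ^ (4 * E) * (eval_mpoly s u + eval_mpoly s (\<lambda>i. - u i))"
    using E0[of E] by (auto simp: E_def)
  define r where "r = 2 * E - k"
  \<comment> \<open>The point \<open>x / \<bar>x\<bar>\<close> does not exist for \<open>x = 0\<close>; one more factor \<open>\<bar>x\<bar>\<^sup>2\<close> makes both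
    sides vanish there.\<close>
  have "q * sq_norm N ^ (r + 1) = Const (1 / 2) * (sq_norm N * s')"
  proof (rule mpoly_eqI)
    fix x
    show "eval_mpoly (q * sq_norm N ^ (r + 1)) x = eval_mpoly (Const (1 / 2) * (sq_norm N * s')) x"
    proof (cases "(\<Sum>i<N. x i ^ 2) = 0")
      case False
      define c where "c = sqrt (\<Sum>i<N. x i ^ 2)"
      define u where "u = (\<lambda>i. x i / c)"
      have c2: "c ^ 2 = (\<Sum>i<N. x i ^ 2)" by (simp add: c_def sum_nonneg)
      have c: "c \<noteq> 0" using False c2 by auto
      have u: "(\<Sum>i<N. u i ^ 2) = 1"
        using c by (simp add: u_def power_divide flip: sum_divide_distrib c2)
      have x: "x = (\<lambda>i. c * u i)" using c by (simp add: u_def)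
      have "eval_mpoly s (\<lambda>i. - u i) = eval_mpoly q (\<lambda>i. - 1 * u i)"
        using s(2)[of "\<lambda>i. - u i"] u by simp
      also have "\<dots> = eval_mpoly q u" using eval_form_scale[OF q, of "- 1" u] by simp
      finally have "eval_mpoly s' x = c ^ (4 * E) * (2 * eval_mpoly q u)"
        using s'(2)[OF u, of c] s(2)[OF u] x by simp
      moreover have "eval_mpoly q x = c ^ (2 * k) * eval_mpoly q u"
        using eval_form_scale[OF q, of c u] x by simp
      moreover have "2 * k + 2 * r = 4 * E" by (simp add: r_def E_def)
      then have "c ^ (2 * k) * (c ^ 2) ^ r = c ^ (4 * E)"
        by (metis power_add power_mult)
      ultimately have "eval_mpoly q x * (c ^ 2) ^ r = eval_mpoly s' x / 2"
        by (simp add: mult_ac)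
      then show ?thesis by (simp flip: c2)
    qed simp
  qed
  moreover have "is_sos N (Const (1 / 2) * (sq_norm N * s'))"
    using s'(1) by (intro is_sos_mult is_sos_Const is_sos_sq_norm) auto
  ultimately show ?thesis using that by metis
qed

section \<open>The form attached to an optimization problem\<close>

lemma mpolys_mono: "n \<le> N \<Longrightarrow> mpolys n \<subseteq> mpolys N"
  by (fastforce simp: mpolys_def)

lemma homogenize_in_forms:
  assumes q: "q \<in> mpolys N" and deg: "total_degree q \<le> k" and v: "v < N"
  shows "homogenize k v q \<in> forms N k"
  unfolding homogenize_def
proof (rule forms_sum)
  fix e assume e: "e \<in> Poly_Mapping.keys q"
  have "monom_degree e \<le> total_degree q"
    unfolding total_degree_def using e by (intro Max_ge) auto
  then have "monom_degree (e + Poly_Mapping.single v (k - monom_degree e)) = k"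
    using deg by (simp add: monom_degree_plus)
  moreover have "Poly_Mapping.keys (e + Poly_Mapping.single v (k - monom_degree e)) \<subseteq> {..<N}"
  proof -
    have "Poly_Mapping.keys e \<subseteq> {..<N}" using q e by (simp add: mpolys_def)
    moreover have "Poly_Mapping.keys (Poly_Mapping.single v (k - monom_degree e)) \<subseteq> {..<N}"
      using v by simp
    ultimately show ?thesis by (intro order.trans[OF Poly_Mapping.keys_add] Un_least)
  qed
  ultimately show "Poly_Mapping.single (e + Poly_Mapping.single v (k - monom_degree e))
      (Poly_Mapping.lookup q e) \<in> forms N k"
    by (simp add: forms_def mpolys_def)
qed

lemma eval_homogenize_at_one:
  assumes "z v = 1"
  shows "eval_mpoly (homogenize k v q) z = eval_mpoly q z"
  using assms by (simp add: homogenize_def monom_eval_plus eval_mpoly_monom_eval[of q])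

lemma f_form_in_forms:
  assumes d: "d \<ge> 1"
    and p: "p \<in> mpolys n" "total_degree p \<le> 2 * d"
    and g: "\<And>i. i \<in> {1..m} \<Longrightarrow> g i \<in> mpolys n" "\<And>i. i \<in> {1..m} \<Longrightarrow> total_degree (g i) \<le> 2 * d"
  shows "f_form n m d p g R \<eta> \<beta> \<gamma> \<in> forms (n + m + 3) (4 * d)"
proof -
  let ?N = "n + m + 3" and ?v = "n + m + 2"
  have hom: "homogenize (2 * d) ?v q \<in> forms ?N (2 * d)" if "q \<in> mpolys n" "total_degree q \<le> 2 * d" for q
    using that mpolys_mono[of n ?N] by (intro homogenize_in_forms) auto
  have pow: "Var i ^ k \<in> forms ?N k" if "i < ?N" for i k
    using forms_power[OF forms_Var[OF that], of k] by simp
  have slack: "Var (n + i) ^ 2 * Var ?v ^ (2 * d - 2) \<in> forms ?N (2 * d)" if "i \<le> m" for i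
  proof -
    have "Var (n + i) ^ 2 * Var ?v ^ (2 * d - 2) \<in> forms ?N (2 + (2 * d - 2))"
      using that by (intro forms_mult pow) auto
    moreover have "2 + (2 * d - 2) = 2 * d" using d by simp
    ultimately show ?thesis by (simp only:)
  qed
  have sq: "q ^ 2 \<in> forms ?N (4 * d)" if "q \<in> forms ?N (2 * d)" for q
    using forms_power[OF that, of 2] by (simp add: mult.commute)
  have T: "((\<Sum>i<n. Var i ^ 2) + (\<Sum>i=0..m. Var (n + i) ^ 2)) ^ d \<in> forms ?N (2 * d)"
    by (rule forms_power, intro forms_add forms_sum pow) auto
  show ?thesis
    unfolding f_form_def Let_def
    by (intro forms_add forms_sum sq forms_diff forms_Const_mult hom slack pow T p g) auto
qed

text \<open>
  Each slack variable is the root that makes its equation hold at \<open>x\<close>. The three bounds add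
  up to \<open>T \<le> ?C\<close>, which is what the existence of the last root, of even order, requires.
\<close>

lemma f_form_vanishes:
  assumes d: "d \<ge> 1"
    and p: "p \<in> mpolys n"
    and g: "\<And>i. i \<in> {1..m} \<Longrightarrow> g i \<in> mpolys n"
    and x: "x \<in> feasible_set n m g"
    and R: "(\<Sum>i<n. x i ^ 2) \<le> R"
    and \<eta>: "\<And>i. i \<in> {1..m} \<Longrightarrow> eval_mpoly (g i) x \<le> \<eta> i"
    and \<beta>: "- eval_mpoly p x \<le> \<beta>"
    and \<gamma>: "eval_mpoly p x \<le> \<gamma>"
  obtains z where "z (n + m + 2) = 1" "eval_mpoly (f_form n m d p g R \<eta> \<beta> \<gamma>) z = 0"
proof
  let ?v = "n + m + 2"
  define T where "T = (\<Sum>i<n. x i ^ 2) + ((\<gamma> - eval_mpoly p x) + (\<Sum>i=1..m. eval_mpoly (g i) x))"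
  let ?C = "R + (\<Sum>i=1..m. \<eta> i) + \<beta> + \<gamma>"
  have g_nonneg: "eval_mpoly (g i) x \<ge> 0" if "i \<in> {1..m}" for i
    using x that by (auto simp: feasible_set_def)
  have "T \<ge> 0"
    unfolding T_def using g_nonneg \<gamma> by (intro add_nonneg_nonneg sum_nonneg) auto
  moreover have "(\<Sum>i=1..m. eval_mpoly (g i) x) \<le> (\<Sum>i=1..m. \<eta> i)"
    by (rule sum_mono) (rule \<eta>)
  then have "T \<le> ?C" using R \<beta> by (simp add: T_def)
  ultimately have TC: "T ^ d \<le> ?C ^ d" by (intro power_mono)
  define z where "z = (\<lambda>i. if i < n then x i
     else if i = n then sqrt (\<gamma> - eval_mpoly p x)
     else if i \<le> n + m then sqrt (eval_mpoly (g (i - n)) x)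
     else if i = n + m + 1 then root (2 * d) (?C ^ d - T ^ d)
     else 1)"
  have zx: "eval_mpoly q z = eval_mpoly q x" if "q \<in> mpolys n" for q
    by (rule eval_mpoly_cong[OF that]) (simp add: z_def)
  show zv: "z ?v = 1" by (simp add: z_def)
  have s0: "z n ^ 2 = \<gamma> - eval_mpoly p x" using \<gamma> by (simp add: z_def)
  have si: "z (n + i) ^ 2 = eval_mpoly (g i) x" if "i \<in> {1..m}" for i
    using g_nonneg[OF that] that by (simp add: z_def)
  have sm: "z (Suc (n + m)) ^ (2 * d) = ?C ^ d - T ^ d"
    using TC d by (simp add: z_def real_root_pow_pos2)
  have "(\<Sum>i=0..m. z (n + i) ^ 2) = z n ^ 2 + (\<Sum>i=1..m. z (n + i) ^ 2)"
    by (simp add: sum.atLeast_Suc_atMost)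
  also have "\<dots> = (\<gamma> - eval_mpoly p x) + (\<Sum>i=1..m. eval_mpoly (g i) x)"
    using s0 si by simp
  finally have "(\<Sum>i<n. z i ^ 2) + (\<Sum>i=0..m. z (n + i) ^ 2) = T"
    by (simp add: T_def z_def)
  then show "eval_mpoly (f_form n m d p g R \<eta> \<beta> \<gamma>) z = 0"
    using sm s0 si zv
    by (simp add: f_form_def Let_def eval_homogenize_at_one zx p g)
qed

lemma f_form_nonneg: "eval_mpoly (f_form n m d p g R \<eta> \<beta> \<gamma>) z \<ge> 0"
  by (simp add: f_form_def Let_def sum_nonneg)

text \<open>
  At a zero with \<open>y = 0\<close> the last square forces all variables to vanish, so a nontrivial
  zero can be rescaled to \<open>y = 1\<close>, where the first squares say that \<open>\<gamma> - p(x)\<close> and the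
  \<open>g\<^sub>i(x)\<close> are squares.
\<close>

lemma f_form_zero_imp_feasible:
  assumes form: "f_form n m d p g R \<eta> \<beta> \<gamma> \<in> forms (n + m + 3) (4 * d)"
    and d: "d \<ge> 1"
    and p: "p \<in> mpolys n"
    and g: "\<And>i. i \<in> {1..m} \<Longrightarrow> g i \<in> mpolys n"
    and zero: "eval_mpoly (f_form n m d p g R \<eta> \<beta> \<gamma>) z = 0"
    and nz: "i0 < n + m + 3" "z i0 \<noteq> 0"
  obtains x where "x \<in> feasible_set n m g" "eval_mpoly p x \<le> \<gamma>"
proof -
  let ?v = "n + m + 2" and ?C = "R + (\<Sum>i=1..m. \<eta> i) + \<beta> + \<gamma>"
  define E1 where "E1 z = \<gamma> * z ?v ^ (2 * d) - eval_mpoly (homogenize (2 * d) ?v p) z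
    - z n ^ 2 * z ?v ^ (2 * d - 2)" for z
  define E2 where "E2 i z = eval_mpoly (homogenize (2 * d) ?v (g i)) z
    - z (n + i) ^ 2 * z ?v ^ (2 * d - 2)" for i z
  define T where "T z = (\<Sum>i<n. z i ^ 2) + (\<Sum>i=0..m. z (n + i) ^ 2)" for z :: "nat \<Rightarrow> real"
  define E3 where "E3 z = ?C ^ d * z ?v ^ (2 * d) - T z ^ d - z (n + (m + 1)) ^ (2 * d)" for z
  have eval: "eval_mpoly (f_form n m d p g R \<eta> \<beta> \<gamma>) z = E1 z ^ 2 + (\<Sum>i=1..m. E2 i z ^ 2) + E3 z ^ 2" for z
    by (simp add: f_form_def Let_def E1_def E2_def E3_def T_def)
  have parts: "E1 z = 0" "\<And>i. i \<in> {1..m} \<Longrightarrow> E2 i z = 0" "E3 z = 0"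
    if "eval_mpoly (f_form n m d p g R \<eta> \<beta> \<gamma>) z = 0" for z
  proof -
    have nonneg: "(\<Sum>i=1..m. E2 i z ^ 2) \<ge> 0" by (simp add: sum_nonneg)
    with that have "E1 z ^ 2 = 0 \<and> (\<Sum>i=1..m. E2 i z ^ 2) = 0 \<and> E3 z ^ 2 = 0"
      unfolding eval by (smt (verit) zero_le_power2)
    then show "E1 z = 0" "\<And>i. i \<in> {1..m} \<Longrightarrow> E2 i z = 0" "E3 z = 0"
      by (auto simp: sum_nonneg_eq_0_iff)
  qed
  have "z ?v \<noteq> 0"
  proof
    assume v0: "z ?v = 0"
    have T: "T z \<ge> 0" by (simp add: T_def sum_nonneg)
    have "z ?v ^ (2 * d) = 0" using d v0 by simp
    then have "E3 z = - (T z ^ d) - z (n + (m + 1)) ^ (2 * d)" by (simp only: E3_def)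
    then have "T z ^ d + z (n + (m + 1)) ^ (2 * d) = 0"
      using parts(3)[OF zero] by simp
    moreover have "T z ^ d \<ge> 0" "z (n + (m + 1)) ^ (2 * d) \<ge> 0" using T by simp_all
    ultimately have "T z ^ d = 0" and "z (n + (m + 1)) ^ (2 * d) = 0"
      by linarith+
    then have T0: "T z = 0" and s0: "z (n + (m + 1)) = 0" by simp_all
    have "(\<Sum>i<n. z i ^ 2) \<ge> 0" "(\<Sum>i=0..m. z (n + i) ^ 2) \<ge> 0" by (simp_all add: sum_nonneg)
    then have sums: "(\<Sum>i<n. z i ^ 2) = 0" "(\<Sum>i=0..m. z (n + i) ^ 2) = 0"
      using T0 unfolding T_def by linarith+
    have x0: "z i = 0" if "i < n" for i
      using sums(1) that by (simp add: sum_nonneg_eq_0_iff)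
    have y0: "z (n + i) = 0" if "i \<le> m" for i
      using sums(2) that by (simp add: sum_nonneg_eq_0_iff)
    consider "i0 < n" | "n \<le> i0 \<and> i0 - n \<le> m" | "i0 = n + (m + 1)" | "i0 = ?v"
      using nz(1) by linarith
    then have "z i0 = 0"
    proof cases
      case 2
      then show ?thesis using y0[of "i0 - n"] by simp
    qed (use x0 s0 v0 in simp_all)
    with nz(2) show False by simp
  qed
  define z' where "z' = (\<lambda>i. (1 / z ?v) * z i)"
  have zero': "eval_mpoly (f_form n m d p g R \<eta> \<beta> \<gamma>) z' = 0"
    using eval_form_scale[OF form, of "1 / z ?v" z] zero by (simp add: z'_def)
  have v1: "z' ?v = 1" using \<open>z ?v \<noteq> 0\<close> by (simp add: z'_def)
  define x where "x = restrict z' {..<n}"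
  have zx: "eval_mpoly q z' = eval_mpoly q x" if "q \<in> mpolys n" for q
    by (rule eval_mpoly_cong[OF that]) (simp add: x_def)
  have "\<gamma> - eval_mpoly p x = z' n ^ 2"
    using parts(1)[OF zero'] v1 p by (simp add: E1_def eval_homogenize_at_one zx)
  then have "eval_mpoly p x \<le> \<gamma>" using zero_le_power2[of "z' n"] by linarith
  moreover have "eval_mpoly (g i) x \<ge> 0" if "i \<in> {1..m}" for i
  proof -
    have "eval_mpoly (g i) x = z' (n + i) ^ 2"
      using parts(2)[OF zero' that] v1 g[OF that] by (simp add: E2_def eval_homogenize_at_one zx)
    then show ?thesis by simp
  qed
  then have "x \<in> feasible_set n m g" by (simp add: feasible_set_def x_def)
  ultimately show ?thesis using that by blast
qed

section \<open>The hierarchy of lower bounds\<close>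

text \<open>
  Both changes are harmless because \<open>\<bar>x\<bar>\<^sup>2\<close> is a sum of squares: raising \<open>r\<close> multiplies by
  powers of it, and lowering \<open>a\<close> adds a nonnegative multiple of such a power.
\<close>

lemma sos_mult_forms_mono:
  assumes mem: "q - Const a * sq_norm N ^ k \<in> sos_mult_forms N (2 * k) r"
    and "r \<le> r'" "b \<le> a"
  shows "q - Const b * sq_norm N ^ k \<in> sos_mult_forms N (2 * k) r'"
proof -
  let ?s = "sq_norm N"
  have sk: "?s ^ k \<in> forms N (2 * k)" using forms_power[OF forms_sq_norm] by simp
  have q: "q - Const b * ?s ^ k = (q - Const a * ?s ^ k) + Const (a - b) * ?s ^ k"
    by (rule mpoly_eqI) (simp add: algebra_simps)
  have "?s ^ r' = ?s ^ r * ?s ^ (r' - r)" using \<open>r \<le> r'\<close> by (simp flip: power_add)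
  then have "(q - Const b * ?s ^ k) * ?s ^ r' =
      ((q - Const a * ?s ^ k) * ?s ^ r) * ?s ^ (r' - r) + Const (a - b) * ?s ^ k * ?s ^ r'"
    unfolding q by (simp add: algebra_simps)
  moreover have "is_sos N \<dots>"
  proof (rule is_sos_add)
    have "is_sos N ((q - Const a * ?s ^ k) * ?s ^ r)" using mem by (simp add: sos_mult_forms_def)
    then show "is_sos N ((q - Const a * ?s ^ k) * ?s ^ r * ?s ^ (r' - r))"
      by (rule is_sos_mult) (rule is_sos_power[OF is_sos_sq_norm])
    show "is_sos N (Const (a - b) * ?s ^ k * ?s ^ r')"
      using \<open>b \<le> a\<close> by (intro is_sos_mult is_sos_power is_sos_sq_norm is_sos_Const) simp
  qed
  moreover have "q - Const b * ?s ^ k \<in> forms N (2 * k)"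
    unfolding q using mem by (intro forms_add forms_Const_mult sk) (simp add: sos_mult_forms_def)
  ultimately show ?thesis by (simp add: sos_mult_forms_def)
qed

theorem theorem4p3p2:
  fixes n m d :: nat
    and p :: real_mpoly
    and g :: "nat \<Rightarrow> real_mpoly"
    and R \<beta> :: real
    and \<eta> :: "nat \<Rightarrow> real"
    and S :: "(nat \<Rightarrow> real) set"
    and pstar :: ereal
    and l :: "nat \<Rightarrow> ereal"
  assumes p: "p \<in> mpolys n"
    and g: "\<And>i. i \<in> {1..m} \<Longrightarrow> g i \<in> mpolys n"
    and S: "S = feasible_set n m g"
    and pstar: "pstar = (INF x\<in>S. ereal (eval_mpoly p x))"
    and d_ge_1: "d \<ge> 1"
    and d: "2 * d = (LEAST k. 0 < k \<and> even k \<and> (\<forall>q\<in>insert p (g ` {1..m}). total_degree q \<le> k))"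
    and R_pos: "R > 0"
    and R_bound: "\<And>x. x \<in> S \<Longrightarrow> (\<Sum>i<n. (x i) ^ 2) \<le> R"
    and eta_bound: "\<And>i x. i \<in> {1..m} \<Longrightarrow> x \<in> S \<Longrightarrow> eval_mpoly (g i) x \<le> \<eta> i"
    and beta_bound: "\<And>x. x \<in> S \<Longrightarrow> - eval_mpoly p x \<le> \<beta>"
    and l: "l = lower_bound n m d p g R \<eta> \<beta>"
  shows "(\<forall>r\<ge>1. l r \<le> pstar) \<and> (\<forall>r r'. 1 \<le> r \<longrightarrow> r \<le> r' \<longrightarrow> l r \<le> l r') \<and> l \<longlonglongrightarrow> pstar"
proof -
  let ?N = "n + m + 3" and ?f = "f_form n m d p g R \<eta> \<beta>"
  define cert where
    "cert r \<gamma> \<longleftrightarrow> ?f \<gamma> - Const (1 / real r) * sq_norm ?N ^ (2 * d) \<in> sos_mult_forms ?N (2 * (2 * d)) r"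
    for r \<gamma>
  have l_eq: "l r = (SUP \<gamma>\<in>{\<gamma>. cert r \<gamma>}. ereal \<gamma>)" for r
    by (simp add: l lower_bound_def Let_def cert_def)
  have deg: "\<forall>q\<in>insert p (g ` {1..m}). total_degree q \<le> 2 * d"
  proof -
    let ?P = "\<lambda>k. 0 < k \<and> even k \<and> (\<forall>q\<in>insert p (g ` {1..m}). total_degree q \<le> k)"
    let ?M = "\<Sum>q\<in>insert p (g ` {1..m}). total_degree q"
    have "?P (2 * ?M + 2)"
    proof (intro conjI ballI)
      fix q assume "q \<in> insert p (g ` {1..m})"
      then have "total_degree q \<le> ?M" by (intro member_le_sum) auto
      then show "total_degree q \<le> 2 * ?M + 2" by simp
    qed auto
    then have "?P (LEAST k. ?P k)" by (rule LeastI)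
    then show ?thesis unfolding d[symmetric] by blast
  qed
  have form: "?f \<gamma> \<in> forms ?N (4 * d)" for \<gamma>
    by (rule f_form_in_forms) (use d_ge_1 p g deg in auto)
  have upper: "l r \<le> pstar" if r: "1 \<le> r" for r
    unfolding l_eq pstar
  proof (intro SUP_least INF_greatest)
    fix \<gamma> x assume "\<gamma> \<in> {\<gamma>. cert r \<gamma>}" and x: "x \<in> S"
    then have sos: "is_sos ?N ((?f \<gamma> - Const (1 / real r) * sq_norm ?N ^ (2 * d)) * sq_norm ?N ^ r)"
      by (simp add: cert_def sos_mult_forms_def)
    show "ereal \<gamma> \<le> ereal (eval_mpoly p x)"
    proof (rule ccontr)
      assume "\<not> ?thesis"
      then have \<gamma>: "eval_mpoly p x \<le> \<gamma>" by simp
      obtain z where z: "z (n + m + 2) = 1" "eval_mpoly (?f \<gamma>) z = 0"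
        using f_form_vanishes[where m = m and g = g and \<eta> = \<eta>, OF d_ge_1 p g x[unfolded S]
          R_bound[OF x] eta_bound[OF _ x] beta_bound[OF x] \<gamma>] by blast
      have "1 \<le> (\<Sum>i<?N. z i ^ 2)"
        using member_le_sum[of "n + m + 2" "{..<?N}" "\<lambda>i. z i ^ 2"] z(1) by simp
      then have "(\<Sum>i<?N. z i ^ 2) ^ (2 * d) * (\<Sum>i<?N. z i ^ 2) ^ r > 0"
        by (intro mult_pos_pos zero_less_power) auto
      then have "- (1 / real r) * ((\<Sum>i<?N. z i ^ 2) ^ (2 * d) * (\<Sum>i<?N. z i ^ 2) ^ r) < 0"
        using r by (intro mult_neg_pos) auto
      moreover have "0 \<le> - (1 / real r) * ((\<Sum>i<?N. z i ^ 2) ^ (2 * d) * (\<Sum>i<?N. z i ^ 2) ^ r)"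
        using is_sos_eval_nonneg[OF sos, of z] z(2) by (simp add: mult.assoc)
      ultimately show False by linarith
    qed
  qed
  have mono_cert: "cert r' \<gamma>" if "cert r \<gamma>" "1 \<le> r" "r \<le> r'" for r r' \<gamma>
    using that unfolding cert_def
    by (elim sos_mult_forms_mono) (auto intro: divide_left_mono)
  have mono: "l r \<le> l r'" if "1 \<le> r" "r \<le> r'" for r r'
    unfolding l_eq using that mono_cert by (intro SUP_subset_mono) auto
  have eventually_cert: "\<exists>r0\<ge>1. cert r0 \<gamma>" if \<gamma>: "ereal \<gamma> < pstar" for \<gamma>
  proof -
    have pos: "eval_mpoly (?f \<gamma>) z > 0" if z: "(\<Sum>i<?N. z i ^ 2) = 1" for z
    proof (rule ccontr)
      assume "\<not> ?thesis"
      then have zero: "eval_mpoly (?f \<gamma>) z = 0"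
        using f_form_nonneg[of n m d p g R \<eta> \<beta> \<gamma> z] by linarith
      obtain i0 where i0: "i0 < ?N" "z i0 \<noteq> 0"
      proof (rule ccontr)
        assume "\<not> thesis"
        then have "\<forall>i<?N. z i = 0" using that by blast
        then show False using z by simp
      qed
      obtain x where "x \<in> feasible_set n m g" "eval_mpoly p x \<le> \<gamma>"
        using f_form_zero_imp_feasible[OF form d_ge_1 p g zero i0] by blast
      then have "pstar \<le> ereal \<gamma>"
        unfolding pstar S by (intro INF_lower2[of x]) auto
      then show False using \<gamma> by simp
    qed
    obtain \<delta> where \<delta>: "\<delta> > 0" "\<And>z. (\<Sum>i<?N. z i ^ 2) = 1 \<Longrightarrow> eval_mpoly (?f \<gamma>) z \<ge> \<delta>"
      using positive_on_sphere_bounded_below[OF forms_imp_mpolys[OF form] pos] by blast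
    \<comment> \<open>Some margin remains after subtracting \<open>1 / (r0 + 1)\<close>, and monotonicity turns
      the exponent \<open>r1\<close> obtained for that fraction into a certificate at a common level.\<close>
    obtain r0 where r0: "1 / real (Suc r0) < \<delta>"
      using reals_Archimedean[OF \<delta>(1)] by (auto simp: inverse_eq_divide)
    let ?q = "?f \<gamma> - Const (1 / real (Suc r0)) * sq_norm ?N ^ (2 * d)"
    have q: "?q \<in> forms ?N (2 * (2 * d))"
      using form[of \<gamma>] forms_power[OF forms_sq_norm, of ?N "2 * d"]
      by (intro forms_diff forms_Const_mult) auto
    obtain r1 where r1: "is_sos ?N (?q * sq_norm ?N ^ r1)"
    proof (rule positive_definite_form_uniform_denominator[OF q])
      fix z :: "nat \<Rightarrow> real" assume z: "(\<Sum>i<?N. z i ^ 2) = 1"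
      have "eval_mpoly ?q z = eval_mpoly (?f \<gamma>) z - 1 / real (Suc r0)"
        by (simp only: eval_mpoly_diff eval_mpoly_mult eval_mpoly_Const eval_mpoly_power eval_mpoly_sq_norm z)
           simp
      then show "eval_mpoly ?q z > 0" using \<delta>(2)[OF z] r0 by linarith
    qed
    have "?q \<in> sos_mult_forms ?N (2 * (2 * d)) r1"
      using q r1 by (simp add: sos_mult_forms_def)
    then have "cert (Suc r0 + r1) \<gamma>"
      unfolding cert_def by (rule sos_mult_forms_mono) (auto intro: divide_left_mono)
    then show ?thesis by (intro exI[of _ "Suc r0 + r1"]) auto
  qed
  have "l \<longlonglongrightarrow> pstar"
  proof (rule order_tendstoI)
    fix a assume "a < pstar"
    then obtain \<gamma> where \<gamma>: "a < ereal \<gamma>" "ereal \<gamma> < pstar" using ereal_dense2 by blast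
    obtain r0 where r0: "1 \<le> r0" "cert r0 \<gamma>" using eventually_cert[OF \<gamma>(2)] by blast
    show "eventually (\<lambda>r. a < l r) sequentially"
    proof (rule eventually_sequentiallyI)
      fix r assume "r0 \<le> r"
      then have "cert r \<gamma>" using mono_cert r0 by blast
      then have "ereal \<gamma> \<le> l r" unfolding l_eq by (intro SUP_upper) auto
      then show "a < l r" using \<gamma>(1) by simp
    qed
  next
    fix a assume "pstar < a"
    show "eventually (\<lambda>r. l r < a) sequentially"
      by (rule eventually_sequentiallyI[of 1]) (use upper \<open>pstar < a\<close> in \<open>auto intro: le_less_trans\<close>)
  qed
  then show ?thesis using upper mono by blast
qed

end
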